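(* Let $\mathbb F$ be a field. For an arbitrary $p$, the problem of classifying three-dimensional arrays over $\mathbb F$ up to equivalence contains the problem of classifying $p$-tuples of three-dimensional arrays over $\mathbb F$ up to simultaneous equivalence. That is: for all positive integers $p,m,n,t$, let $\mathcal X=(\underline X_1,\dots,\underline X_p)$ be a $p$-tuple of variable arrays of size $m\times n\times t$ whose entries are independent variables (without repetition). Then there exist positive integers $\delta_1,\delta_2,\delta_3$ and a variable array $\underline F(\mathcal X)$ of size $\delta_1\times\delta_2\times\delta_3$, in which every $\underline X_i$ is a subarray and each entry outside of $\underline X_1,\dots,\underline X_p$ is $0$ or $1$, such that for all $p$-tuples $\mathcal A=(\underline A_1,\dots,\underline A_p)$ and $\mathcal B=(\underline B_1,\dots,\underline B_p)$ of $m\times n\times t$ arrays over $\mathbb F$: $\mathcal A$ and $\mathcal B$ are simultaneously equivalent if and only if $\underline F(\mathcal A)$ and $\underline F(\mathcal B)$ are equivalent.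
   Context: **Equivalence.** For arrays $\underline A=[a_{ijk}]$, $\underline B=[b_{ijk}]$ of size $m\times n\times t$ over $\mathbb F$ and nonsingular matrices $R=[u_{ii'}]\in\mathbb F^{m\times m}$, $S=[v_{jj'}]\in\mathbb F^{n\times n}$, $U=[w_{kk'}]\in\mathbb F^{t\times t}$, write $(R,S,U):\underline A\xrightarrow{\sim}\underline B$ if $b_{i'j'k'}=\sum_{i,j,k}a_{ijk}u_{ii'}v_{jj'}w_{kk'}$ for all $i',j',k'$. $\underline A$ and $\underline B$ are equivalent if such $R,S,U$ exist. The $p$-tuples $\mathcal A$ and $\mathcal B$ are simultaneously equivalent if there is one triple $(R,S,U)$ of nonsingular matrices with $(R,S,U):\underline A_i\xrightarrow{\sim}\underline B_i$ for all $i=1,\dots,p$. **Subarrays.** An array is a subarray of a three-dimensional array $\underline B=[b_{j_1j_2j_3}]$ if it coincides with $[b_{j_1j_2j_3}]_{j_1\in J_1,\,j_2\in J_2,\,j_3\in J_3}$ for some nonempty subsets $J_1,J_2,J_3$ of the index sets, up to deleting indices $j_k$ with one-element $J_k$. **Variable arrays.** A variable array is an array whose entries are variables or the constants $0,1$; $\underline F(\mathcal A)$ is obtained from $\underline F(\mathcal X)$ by substituting the entries of $\mathcal A$ for the corresponding variables of $\mathcal X$. *)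

theory Defs
  imports "Jordan_Normal_Form.Matrix"
begin

(* Arrays are functions whose size is carried separately: an array of size m x n x t is read
   only at indices i < m, j < n, k < t, and no definition below depends on its values elsewhere. *)

type_synonym 'a array3 = "nat \<Rightarrow> nat \<Rightarrow> nat \<Rightarrow> 'a"

definition transforms ::
    "nat \<Rightarrow> nat \<Rightarrow> nat \<Rightarrow> 'a mat \<Rightarrow> 'a mat \<Rightarrow> 'a mat \<Rightarrow> 'a :: field array3 \<Rightarrow> 'a array3 \<Rightarrow> bool" where
  "transforms m n t R S U A B \<longleftrightarrow>
     (\<forall>i'<m. \<forall>j'<n. \<forall>k'<t.
        B i' j' k' = (\<Sum>i<m. \<Sum>j<n. \<Sum>k<t. A i j k * R $$ (i, i') * S $$ (j, j') * U $$ (k, k')))"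

definition nonsingular :: "nat \<Rightarrow> 'a :: field mat \<Rightarrow> bool" where
  "nonsingular m R \<longleftrightarrow> R \<in> carrier_mat m m \<and> invertible_mat R"

definition equivalent3 ::
    "nat \<Rightarrow> nat \<Rightarrow> nat \<Rightarrow> 'a :: field array3 \<Rightarrow> 'a array3 \<Rightarrow> bool" where
  "equivalent3 m n t A B \<longleftrightarrow>
     (\<exists>R S U. nonsingular m R \<and> nonsingular n S \<and> nonsingular t U \<and> transforms m n t R S U A B)"

(* A p-tuple of arrays is a family read only at indices i < p. *)

definition simultaneously_equivalent3 ::
    "nat \<Rightarrow> nat \<Rightarrow> nat \<Rightarrow> nat \<Rightarrow> (nat \<Rightarrow> 'a :: field array3) \<Rightarrow> (nat \<Rightarrow> 'a array3) \<Rightarrow> bool" where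
  "simultaneously_equivalent3 p m n t A B \<longleftrightarrow>
     (\<exists>R S U. nonsingular m R \<and> nonsingular n S \<and> nonsingular t U \<and>
        (\<forall>i<p. transforms m n t R S U (A i) (B i)))"

(* The m x n x t array A is the subarray of the d1 x d2 x d3 array B at J1 x J2 x J3, where each
   index set is enumerated in increasing order.  Only three-dimensional subarrays are considered,
   so no index with a one-element index set is dropped. *)

definition subarray_at ::
    "nat \<Rightarrow> nat \<Rightarrow> nat \<Rightarrow> 'a array3 \<Rightarrow> nat \<Rightarrow> nat \<Rightarrow> nat \<Rightarrow> 'a array3 \<Rightarrow>
     nat set \<Rightarrow> nat set \<Rightarrow> nat set \<Rightarrow> bool" where
  "subarray_at m n t A d1 d2 d3 B J1 J2 J3 \<longleftrightarrow>
     J1 \<subseteq> {..<d1} \<and> J2 \<subseteq> {..<d2} \<and> J3 \<subseteq> {..<d3} \<and>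
     J1 \<noteq> {} \<and> J2 \<noteq> {} \<and> J3 \<noteq> {} \<and>
     card J1 = m \<and> card J2 = n \<and> card J3 = t \<and>
     (\<forall>i<m. \<forall>j<n. \<forall>k<t.
        A i j k = B (sorted_list_of_set J1 ! i) (sorted_list_of_set J2 ! j) (sorted_list_of_set J3 ! k))"

datatype 'v entry = Var 'v | Const0 | Const1

fun subst_entry :: "('v \<Rightarrow> 'a :: field) \<Rightarrow> 'v entry \<Rightarrow> 'a" where
  "subst_entry s (Var x) = s x"
| "subst_entry s Const0 = 0"
| "subst_entry s Const1 = 1"

(* The variable named (l, i, j, k) is the (i, j, k) entry of the l-th array of the generic tuple,
   so distinct positions carry distinct variables. *)

type_synonym varname = "nat \<times> nat \<times> nat \<times> nat"

definition generic_tuple :: "nat \<Rightarrow> varname entry array3" where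
  "generic_tuple l i j k = Var (l, i, j, k)"

definition subst_tuple ::
    "varname entry array3 \<Rightarrow> (nat \<Rightarrow> 'a :: field array3) \<Rightarrow> 'a array3" where
  "subst_tuple F A = (\<lambda>a b c. subst_entry (\<lambda>(l, i, j, k). A l i j k) (F a b c))"

definition contains_generic_tuple ::
    "nat \<Rightarrow> nat \<Rightarrow> nat \<Rightarrow> nat \<Rightarrow> nat \<Rightarrow> nat \<Rightarrow> nat \<Rightarrow> varname entry array3 \<Rightarrow> bool" where
  "contains_generic_tuple p m n t d1 d2 d3 F \<longleftrightarrow>
     (\<exists>J1 J2 J3.
        (\<forall>l<p. subarray_at m n t (generic_tuple l) d1 d2 d3 F (J1 l) (J2 l) (J3 l)) \<and>
        (\<forall>a<d1. \<forall>b<d2. \<forall>c<d3.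
           \<not> (\<exists>l<p. a \<in> J1 l \<and> b \<in> J2 l \<and> c \<in> J3 l) \<longrightarrow> F a b c \<in> {Const0, Const1}))"

end

theory Submission
  imports Defs "Jordan_Normal_Form.Matrix_Kernel" "HOL-Library.Nat_Bijection"
begin

text \<open>View an array of size \<open>d1 \<times> d2 \<times> d3\<close> as a pencil, a linear map from vectors \<open>v\<close> to
  \<open>d1 \<times> d2\<close> matrices. Concatenating the \<open>p\<close> arrays along the third direction gives a pencil in
  \<open>v = (v_0, \<dots>, v_{p-1})\<close>, and simultaneous equivalence is equivalence in which the third
  matrix has the form \<open>I_p \<otimes> U\<close>. To force this form, add to the pencil diagonal blocks
  (bricks), the columns \<open>\<Sum>l\<in>S. v_l\<close> for all \<open>S = {l, l'}\<close>, with multiplicities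
  \<open>(n + 1) * 2 ^ \<alpha>\<close>. The nullity of the pencil at \<open>v\<close> then tells which of these sums vanish at
  \<open>v\<close>, so an equivalence preserves the subspaces \<open>v_l = 0\<close> and \<open>v_l + v_{l'} = 0\<close>, and this
  makes the third matrix \<open>I_p \<otimes> U\<close>. Such a matrix acts on the bricks as a row transformation
  and can be undone there. Finally the bricks, having only scalar endomorphisms, can be cancelled
  one by one as in the Krull-Schmidt theorem.\<close>

subsection \<open>Block matrices\<close>

lemma nonsingular_iff:
  "nonsingular n P \<longleftrightarrow>
    P \<in> carrier_mat n n \<and> (\<exists>P' \<in> carrier_mat n n. P * P' = 1\<^sub>m n \<and> P' * P = 1\<^sub>m n)"
proof
  assume "nonsingular n P"
  then obtain P' where P: "P \<in> carrier_mat n n" and i: "P * P' = 1\<^sub>m n" "P' * P = 1\<^sub>m (dim_row P')"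
    unfolding nonsingular_def invertible_mat_def inverts_mat_def by auto
  \<comment> \<open>The inverse given by \<open>invertible_mat\<close> comes without a size;
    comparing dimensions in the two identities fixes it.\<close>
  have "dim_col P' = n" using arg_cong[OF i(1), of dim_col] by simp
  moreover have "dim_row P' = n" using arg_cong[OF i(2), of dim_col] P by simp
  ultimately show "P \<in> carrier_mat n n \<and> (\<exists>P' \<in> carrier_mat n n. P * P' = 1\<^sub>m n \<and> P' * P = 1\<^sub>m n)"
    using P i by auto
next
  assume "P \<in> carrier_mat n n \<and> (\<exists>P' \<in> carrier_mat n n. P * P' = 1\<^sub>m n \<and> P' * P = 1\<^sub>m n)"
  then show "nonsingular n P"
    unfolding nonsingular_def invertible_mat_def inverts_mat_def by (auto simp: square_mat.simps)
qed

lemma nonsingularI: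
  assumes "P \<in> carrier_mat n n" "P' \<in> carrier_mat n n" "P * P' = 1\<^sub>m n"
  shows "nonsingular n P"
  using assms mat_mult_left_right_inverse[OF assms] unfolding nonsingular_iff by auto

lemma nonsingularE:
  assumes "nonsingular n P"
  obtains P' where "P \<in> carrier_mat n n" "P' \<in> carrier_mat n n" "nonsingular n P'"
    "P * P' = 1\<^sub>m n" "P' * P = 1\<^sub>m n"
  using assms unfolding nonsingular_iff by blast

lemma nonsingular_one: "nonsingular n (1\<^sub>m n)"
  by (rule nonsingularI[of _ _ "1\<^sub>m n"]) auto

lemma nonsingular_mult:
  assumes "nonsingular n P" "nonsingular n Q"
  shows "nonsingular n (P * Q)"
proof -
  obtain P' where P: "P \<in> carrier_mat n n" "P' \<in> carrier_mat n n" "P * P' = 1\<^sub>m n"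
    using assms(1) by (rule nonsingularE) blast
  obtain Q' where Q: "Q \<in> carrier_mat n n" "Q' \<in> carrier_mat n n" "Q * Q' = 1\<^sub>m n"
    using assms(2) by (rule nonsingularE) blast
  have "(P * Q) * (Q' * P') = P * (Q * Q') * P'"
    using P(1,2) Q(1,2) by (simp add: assoc_mult_mat[of _ n n _ n _ n])
  also have "\<dots> = 1\<^sub>m n" using P Q by simp
  finally show ?thesis using P Q by (intro nonsingularI[of _ _ "Q' * P'"]) auto
qed

lemma nonsingular_transpose:
  assumes "nonsingular n P"
  shows "nonsingular n (transpose_mat P)"
proof -
  obtain P' where P: "P \<in> carrier_mat n n" "P' \<in> carrier_mat n n" "P' * P = 1\<^sub>m n"
    using assms by (rule nonsingularE) blast
  have "transpose_mat P * transpose_mat P' = 1\<^sub>m n"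
    using P transpose_mult[of P' n n P n] by simp
  then show ?thesis using P by (intro nonsingularI[of _ _ "transpose_mat P'"]) auto
qed

abbreviation dsum_mat :: "'a :: zero mat \<Rightarrow> 'a mat \<Rightarrow> 'a mat" where
  "dsum_mat A D \<equiv> four_block_mat A (0\<^sub>m (dim_row A) (dim_col D)) (0\<^sub>m (dim_row D) (dim_col A)) D"

lemma dsum_mat_mult:
  fixes A B :: "'a :: comm_ring_1 mat"
  assumes "A \<in> carrier_mat a b" "B \<in> carrier_mat b c" "D \<in> carrier_mat s t" "E \<in> carrier_mat t u"
  shows "dsum_mat A D * dsum_mat B E = dsum_mat (A * B) (D * E)"
  using assms by (subst mult_four_block_mat[of _ a b _ t _ s _ _ c _ u]) auto

lemma nonsingular_dsum_mat:
  assumes "nonsingular n P" "nonsingular t Q"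
  shows "nonsingular (n + t) (dsum_mat P Q)"
proof -
  obtain P' where P: "P \<in> carrier_mat n n" "P' \<in> carrier_mat n n" "P * P' = 1\<^sub>m n"
    using assms(1) by (rule nonsingularE) blast
  obtain Q' where Q: "Q \<in> carrier_mat t t" "Q' \<in> carrier_mat t t" "Q * Q' = 1\<^sub>m t"
    using assms(2) by (rule nonsingularE) blast
  have "dsum_mat P Q * dsum_mat P' Q' = 1\<^sub>m (n + t)"
    using P Q by (subst dsum_mat_mult[of _ n n _ n _ t t _ t]) auto
  then show ?thesis using P Q by (intro nonsingularI[of _ _ "dsum_mat P' Q'"]) auto
qed

lemma four_block_mat_inject:
  assumes "four_block_mat A B C D = four_block_mat A' B' C' D'"
    and "A \<in> carrier_mat a b" "B \<in> carrier_mat a s" "C \<in> carrier_mat t b" "D \<in> carrier_mat t s"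
    and "A' \<in> carrier_mat a b" "B' \<in> carrier_mat a s" "C' \<in> carrier_mat t b" "D' \<in> carrier_mat t s"
  shows "A = A'" "B = B'" "C = C'" "D = D'"
proof -
  have e: "four_block_mat A B C D $$ (i, j) = four_block_mat A' B' C' D' $$ (i, j)" for i j
    using assms(1) by simp
  show "A = A'" 
  proof (rule eq_matI)
    fix i j assume "i < dim_row A'" "j < dim_col A'"
    then show "A $$ (i, j) = A' $$ (i, j)" using e[of i j] assms(2-) by simp
  qed (use assms in auto)
  show "B = B'" 
  proof (rule eq_matI)
    fix i j assume "i < dim_row B'" "j < dim_col B'"
    then show "B $$ (i, j) = B' $$ (i, j)" using e[of i "b + j"] assms(2-) by simp
  qed (use assms in auto)
  show "C = C'" 
  proof (rule eq_matI)
    fix i j assume "i < dim_row C'" "j < dim_col C'"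
    then show "C $$ (i, j) = C' $$ (i, j)" using e[of "a + i" j] assms(2-) by simp
  qed (use assms in auto)
  show "D = D'" 
  proof (rule eq_matI)
    fix i j assume "i < dim_row D'" "j < dim_col D'"
    then show "D $$ (i, j) = D' $$ (i, j)" using e[of "a + i" "b + j"] assms(2-) by simp
  qed (use assms in auto)
qed

lemma four_block_mat_cases:
  assumes "P \<in> carrier_mat (a + s) (b + t)"
  obtains A B C D where "P = four_block_mat A B C D" "A \<in> carrier_mat a b" "B \<in> carrier_mat a t"
    "C \<in> carrier_mat s b" "D \<in> carrier_mat s t"
proof -
  obtain A B C D where s: "split_block P a b = (A, B, C, D)" by (cases "split_block P a b") auto
  from split_block[OF s, of s t] assms that show thesis by auto
qed

subsection \<open>Equivalence of matrix families and cancellation\<close>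

text \<open>Strict equivalence: a single pair \<open>P\<close>, \<open>T\<close> serves all
  parameters \<open>v\<close>. The dependence of \<open>f v\<close> on \<open>v\<close> is
  arbitrary, so direct sums and cancellation are treated for families of matrices in
  general.\<close>

definition pencil_equiv :: "nat \<Rightarrow> nat \<Rightarrow> ('b \<Rightarrow> 'a :: field mat) \<Rightarrow> ('b \<Rightarrow> 'a mat) \<Rightarrow> bool" where
  "pencil_equiv a b f g \<longleftrightarrow>
    (\<exists>P T. nonsingular a P \<and> nonsingular b T \<and> (\<forall>v. g v = P * f v * T))"

lemma pencil_equiv_refl:
  assumes "\<And>v. f v \<in> carrier_mat a b"
  shows "pencil_equiv a b f f"
proof -
  have "f v = 1\<^sub>m a * f v * 1\<^sub>m b" for v using assms[of v] by simp
  then show ?thesis using nonsingular_one unfolding pencil_equiv_def by blast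
qed

lemma pencil_equiv_trans:
  assumes f: "\<And>v. f v \<in> carrier_mat a b" and "pencil_equiv a b f g" "pencil_equiv a b g h"
  shows "pencil_equiv a b f h"
proof -
  obtain P T where 1: "nonsingular a P" "nonsingular b T" "\<And>v. g v = P * f v * T"
    using assms(2) unfolding pencil_equiv_def by auto
  obtain P' T' where 2: "nonsingular a P'" "nonsingular b T'" "\<And>v. h v = P' * g v * T'"
    using assms(3) unfolding pencil_equiv_def by auto
  have c: "P \<in> carrier_mat a a" "P' \<in> carrier_mat a a" "T \<in> carrier_mat b b" "T' \<in> carrier_mat b b"
    using 1 2 by (auto simp: nonsingular_def)
  have "h v = (P' * P) * f v * (T * T')" for v
    using c f[of v] by (simp add: 1(3) 2(3) assoc_mult_mat[of _ a a _ b _ b]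
      assoc_mult_mat[of _ a a _ a _ b] assoc_mult_mat[of _ a b _ b _ b])
  then show ?thesis using 1 2 nonsingular_mult unfolding pencil_equiv_def by metis
qed

lemma pencil_equiv_sym:
  assumes f: "\<And>v. f v \<in> carrier_mat a b" and "pencil_equiv a b f g"
  shows "pencil_equiv a b g f"
proof -
  obtain P T where 1: "nonsingular a P" "nonsingular b T" "\<And>v. g v = P * f v * T"
    using assms(2) unfolding pencil_equiv_def by auto
  obtain P' where P: "P \<in> carrier_mat a a" "P' \<in> carrier_mat a a" "nonsingular a P'" "P' * P = 1\<^sub>m a"
    using 1(1) by (rule nonsingularE) blast
  obtain T' where T: "T \<in> carrier_mat b b" "T' \<in> carrier_mat b b" "nonsingular b T'" "T * T' = 1\<^sub>m b"
    using 1(2) by (rule nonsingularE) blast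
  have "P' * g v * T' = (P' * P) * f v * (T * T')" for v
    using P(1,2) T(1,2) f[of v] by (simp add: 1(3) assoc_mult_mat[of _ a a _ b _ b]
      assoc_mult_mat[of _ a a _ a _ b] assoc_mult_mat[of _ a b _ b _ b])
  then have "f v = P' * g v * T'" for v using P T f[of v] by simp
  then show ?thesis using P T unfolding pencil_equiv_def by blast
qed

lemma pencil_equiv_dsum:
  assumes f: "\<And>v. f v \<in> carrier_mat a b" and d: "\<And>v. d v \<in> carrier_mat s t"
    and "pencil_equiv a b f g" "pencil_equiv s t d e"
  shows "pencil_equiv (a + s) (b + t) (\<lambda>v. dsum_mat (f v) (d v)) (\<lambda>v. dsum_mat (g v) (e v))"
proof -
  obtain P T where 1: "nonsingular a P" "nonsingular b T" "\<And>v. g v = P * f v * T"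
    using assms(3) unfolding pencil_equiv_def by auto
  obtain P' T' where 2: "nonsingular s P'" "nonsingular t T'" "\<And>v. e v = P' * d v * T'"
    using assms(4) unfolding pencil_equiv_def by auto
  have c: "P \<in> carrier_mat a a" "P' \<in> carrier_mat s s" "T \<in> carrier_mat b b" "T' \<in> carrier_mat t t"
    using 1 2 by (auto simp: nonsingular_def)
  have "dsum_mat (g v) (e v) = dsum_mat P P' * dsum_mat (f v) (d v) * dsum_mat T T'" for v
    using c f[of v] d[of v] unfolding 1(3) 2(3)
    by (subst dsum_mat_mult[of _ a a _ b _ s s _ t], simp_all only:,
        subst dsum_mat_mult[of _ a b _ b _ s t _ t], auto)
  then show ?thesis using 1 2 nonsingular_dsum_mat unfolding pencil_equiv_def by blast
qed

lemma minus_mult_minus_mat: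
  fixes A :: "'a :: comm_ring_1 mat"
  assumes "A \<in> carrier_mat a b" "B \<in> carrier_mat a b" "C \<in> carrier_mat b c" "D \<in> carrier_mat b c"
  shows "(A - B) * (C - D) = A * C - A * D - (B * C - B * D)"
proof -
  have "C - D \<in> carrier_mat b c" using assms by (auto intro: minus_carrier_mat)
  from minus_mult_distrib_mat[OF assms(1,2) this] show ?thesis
    using mult_minus_distrib_mat[OF assms(1,3,4)] mult_minus_distrib_mat[OF assms(2-4)] by simp
qed

text \<open>Schur complements: the inverse of \<open>A'\<close> is \<open>A - c\<inverse> B C\<close> if \<open>c \<noteq> 0\<close>; for \<open>c = 0\<close>
  apply this after composing with an automorphism that makes the lower right block \<open>1\<close>.\<close>

lemma nonsingular_corner:
  fixes A :: "'a :: field mat"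
  assumes P: "A \<in> carrier_mat a a" "B \<in> carrier_mat a s" "C \<in> carrier_mat s a"
    and Q: "A' \<in> carrier_mat a a" "B' \<in> carrier_mat a s" "C' \<in> carrier_mat s a" "D' \<in> carrier_mat s s"
    and inv: "four_block_mat A B C (c \<cdot>\<^sub>m 1\<^sub>m s) * four_block_mat A' B' C' D' = 1\<^sub>m (a + s)"
  shows "nonsingular a (if c = 0 then A' - B' * C' else A')"
proof -
  let ?D = "c \<cdot>\<^sub>m 1\<^sub>m s"
  have D: "?D \<in> carrier_mat s s" by simp
  have DC: "?D * C' = c \<cdot>\<^sub>m C'" and DD: "?D * D' = c \<cdot>\<^sub>m D'"
    using Q mult_smult_assoc_mat[of "1\<^sub>m s" s s C' a c] mult_smult_assoc_mat[of "1\<^sub>m s" s s D' s c]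
    by auto
  have "four_block_mat (A * A' + B * C') (A * B' + B * D') (C * A' + c \<cdot>\<^sub>m C') (C * B' + c \<cdot>\<^sub>m D')
     = four_block_mat (1\<^sub>m a) (0\<^sub>m a s) (0\<^sub>m s a) (1\<^sub>m s)"
    using inv unfolding mult_four_block_mat[OF P D Q] DC DD by simp
  moreover have "A * A' + B * C' \<in> carrier_mat a a" "A * B' + B * D' \<in> carrier_mat a s"
    "C * A' + c \<cdot>\<^sub>m C' \<in> carrier_mat s a" "C * B' + c \<cdot>\<^sub>m D' \<in> carrier_mat s s"
    using P Q by auto
  ultimately have e1: "A * A' + B * C' = 1\<^sub>m a" and e3: "C * A' + c \<cdot>\<^sub>m C' = 0\<^sub>m s a"
    and e4: "C * B' + c \<cdot>\<^sub>m D' = 1\<^sub>m s"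
    by (rule four_block_mat_inject; simp)+
  show ?thesis
  proof (cases "c = 0")
    case False
    have CA: "C * A' = (- c) \<cdot>\<^sub>m C'"
    proof (rule eq_matI)
      fix i j assume "i < dim_row ((- c) \<cdot>\<^sub>m C')" "j < dim_col ((- c) \<cdot>\<^sub>m C')"
      then show "(C * A') $$ (i, j) = ((- c) \<cdot>\<^sub>m C') $$ (i, j)"
        using arg_cong[OF e3, of "\<lambda>X. X $$ (i, j)"] P Q
        by (simp add: eq_neg_iff_add_eq_0)
    qed (use P Q in auto)
    have "(A - inverse c \<cdot>\<^sub>m (B * C)) * A' = A * A' - inverse c \<cdot>\<^sub>m (B * (C * A'))"
      using P Q by (simp add: minus_carrier_mat minus_mult_distrib_mat[of _ a a] mult_smult_assoc_mat[of _ a a]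
        assoc_mult_mat[of _ a s _ a _ a])
    also have "\<dots> = A * A' - inverse c \<cdot>\<^sub>m ((- c) \<cdot>\<^sub>m (B * C'))"
      using P Q unfolding CA by (simp add: mult_smult_distrib[of _ a s])
    also have "\<dots> = A * A' + B * C'"
      using P Q False by (intro eq_matI) auto
    finally have "(A - inverse c \<cdot>\<^sub>m (B * C)) * A' = 1\<^sub>m a" using e1 by simp
    then have "A' * (A - inverse c \<cdot>\<^sub>m (B * C)) = 1\<^sub>m a"
      using P Q by (rule_tac mat_mult_left_right_inverse[of _ a]) (auto intro!: minus_carrier_mat)
    then show ?thesis using False P Q
      by (auto intro!: minus_carrier_mat nonsingularI[of _ _ "A - inverse c \<cdot>\<^sub>m (B * C)"])
  next
    case True
    have z: "0 \<cdot>\<^sub>m C' = 0\<^sub>m s a" "0 \<cdot>\<^sub>m D' = 0\<^sub>m s s" using Q by auto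
    have CA: "C * A' = 0\<^sub>m s a" and CB: "C * B' = 1\<^sub>m s"
      using e3 e4 P Q unfolding True z by auto
    \<comment> \<open>Multiplying the first factor on the right by the block matrix with rows
      \<open>1, B'\<close> and \<open>0, 1\<close> turns its blocks into \<open>A\<close>,
      \<open>A * B' + B\<close>, \<open>C\<close> and \<open>C * B' = 1\<close>, and the corner of
      the inverse into \<open>A' - B' * C'\<close>. \<open>Y\<close> is the Schur complement
      \<open>A - (A * B' + B) * C\<close> of the new matrix.\<close>
    define Y where "Y = A - (A * B' * C + B * C)"
    have Y: "Y \<in> carrier_mat a a" unfolding Y_def using P Q by (auto intro!: minus_carrier_mat)
    have X: "A' - B' * C' \<in> carrier_mat a a" using P Q by (auto intro!: minus_carrier_mat)
    have 1: "A * B' * C * A' = 0\<^sub>m a a" "B * C * A' = 0\<^sub>m a a"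
      using P Q CA assoc_mult_mat[of "A * B'" a s C a A' a] assoc_mult_mat[of B a s C a A' a] by simp_all
    have CBC: "C * (B' * C') = C'"
      using P Q CB assoc_mult_mat[of C s a B' s C' a] by simp
    have 2: "A * B' * C * (B' * C') = A * B' * C'" "B * C * (B' * C') = B * C'"
      using P Q CBC assoc_mult_mat[of "A * B'" a s C a "B' * C'" a]
        assoc_mult_mat[of B a s C a "B' * C'" a] by simp_all
    have "Y * (A' - B' * C') = A * A' - A * (B' * C')
        - ((A * B' * C + B * C) * A' - (A * B' * C + B * C) * (B' * C'))"
      unfolding Y_def using P Q by (intro minus_mult_minus_mat[of _ a a]) auto
    also have "(A * B' * C + B * C) * A' = 0\<^sub>m a a"
      using P Q 1 by (subst add_mult_distrib_mat[of _ a a]) auto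
    also have "(A * B' * C + B * C) * (B' * C') = A * B' * C' + B * C'"
      using P Q 2 by (subst add_mult_distrib_mat[of _ a a]) auto
    also have "A * (B' * C') = A * B' * C'" using P Q by (simp add: assoc_mult_mat[of _ a a _ s _ a])
    also have "A * A' - A * B' * C' - (0\<^sub>m a a - (A * B' * C' + B * C')) = A * A' + B * C'"
      using P Q by (intro eq_matI) auto
    finally have "Y * (A' - B' * C') = 1\<^sub>m a" using e1 by simp
    then have "(A' - B' * C') * Y = 1\<^sub>m a" by (rule mat_mult_left_right_inverse[OF Y X])
    then show ?thesis using True X Y by (auto intro!: nonsingularI[of _ _ Y])
  qed
qed

text \<open>A direct sum has zero off-diagonal blocks, so both products are computed block by block.
  Hence each block of a morphism between direct sums is itself a morphism between the
  summands.\<close>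

lemma dsum_intertwine:
  fixes f :: "'a :: field mat"
  assumes fg: "f \<in> carrier_mat a b" "g \<in> carrier_mat a b" "d \<in> carrier_mat s t"
    and P: "A \<in> carrier_mat a a" "B \<in> carrier_mat a s" "C \<in> carrier_mat s a" "D \<in> carrier_mat s s"
    and T: "A' \<in> carrier_mat b b" "B' \<in> carrier_mat b t" "C' \<in> carrier_mat t b" "D' \<in> carrier_mat t t"
    and eq: "four_block_mat A B C D * dsum_mat f d = dsum_mat g d * four_block_mat A' B' C' D'"
  shows "A * f = g * A'" "B * d = g * B'" "C * f = d * C'" "D * d = d * D'"
proof -
  have "four_block_mat (A * f) (B * d) (C * f) (D * d) = four_block_mat A B C D * dsum_mat f d"
    using P fg by (subst mult_four_block_mat[of _ a a _ s _ s _ _ b _ t]) auto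
  also have "\<dots> = four_block_mat (g * A') (g * B') (d * C') (d * D')"
    unfolding eq using T fg by (subst mult_four_block_mat[of _ a b _ t _ s _ _ b _ t]) auto
  finally have e: "four_block_mat (A * f) (B * d) (C * f) (D * d)
    = four_block_mat (g * A') (g * B') (d * C') (d * D')" .
  show "A * f = g * A'" "B * d = g * B'" "C * f = d * C'" "D * d = d * D'"
    by (rule four_block_mat_inject[OF e, of a b t s]; use P T fg in simp)+
qed

text \<open>The exchange argument of the Krull-Schmidt theorem. The block of the isomorphism from
  \<open>d\<close> to \<open>d\<close> is an endomorphism of \<open>d\<close>, hence a scalar
  \<open>c\<close>. Then a corner of the inverse, corrected by a morphism through \<open>d\<close>
  when \<open>c = 0\<close>, is an isomorphism from \<open>g\<close> to \<open>f\<close>.\<close>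

lemma pencil_equiv_cancel:
  assumes f: "\<And>v. f v \<in> carrier_mat a b" and g: "\<And>v. g v \<in> carrier_mat a b"
    and d: "\<And>v. d v \<in> carrier_mat s t"
    and brick: "\<And>X Y. X \<in> carrier_mat s s \<Longrightarrow> Y \<in> carrier_mat t t \<Longrightarrow> (\<And>v. X * d v = d v * Y) \<Longrightarrow>
      \<exists>c. X = c \<cdot>\<^sub>m 1\<^sub>m s \<and> Y = c \<cdot>\<^sub>m 1\<^sub>m t"
    and equiv: "pencil_equiv (a + s) (b + t) (\<lambda>v. dsum_mat (f v) (d v)) (\<lambda>v. dsum_mat (g v) (d v))"
  shows "pencil_equiv a b f g"
proof -
  obtain P T where ns: "nonsingular (a + s) P" "nonsingular (b + t) T"
    and eq: "\<And>v. dsum_mat (g v) (d v) = P * dsum_mat (f v) (d v) * T"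
    using equiv unfolding pencil_equiv_def by auto
  obtain P' where P: "P \<in> carrier_mat (a + s) (a + s)" "P' \<in> carrier_mat (a + s) (a + s)"
    "P * P' = 1\<^sub>m (a + s)" "P' * P = 1\<^sub>m (a + s)"
    using ns(1) by (rule nonsingularE) blast
  obtain T' where T: "T \<in> carrier_mat (b + t) (b + t)" "T' \<in> carrier_mat (b + t) (b + t)"
    "T * T' = 1\<^sub>m (b + t)" "T' * T = 1\<^sub>m (b + t)"
    using ns(2) by (rule nonsingularE) blast
  have F: "dsum_mat (f v) (d v) \<in> carrier_mat (a + s) (b + t)" for v
    using f[of v] d[of v] by auto
  have eq1: "P * dsum_mat (f v) (d v) = dsum_mat (g v) (d v) * T'" for v
  proof -
    have "dsum_mat (g v) (d v) * T' = P * dsum_mat (f v) (d v) * (T * T')"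
      unfolding eq by (rule assoc_mult_mat[OF mult_carrier_mat[OF P(1) F] T(1,2)])
    then show ?thesis unfolding T(3) using right_mult_one_mat[OF mult_carrier_mat[OF P(1) F]] by simp
  qed
  have eq2: "P' * dsum_mat (g v) (d v) = dsum_mat (f v) (d v) * T" for v
  proof -
    have "P' * dsum_mat (g v) (d v) = P' * (P * (dsum_mat (f v) (d v) * T))"
      unfolding eq by (subst assoc_mult_mat[OF P(1) F T(1)]) simp
    also have "\<dots> = (P' * P) * (dsum_mat (f v) (d v) * T)"
      by (rule assoc_mult_mat[OF P(2,1) mult_carrier_mat[OF F T(1)], symmetric])
    finally show ?thesis unfolding P(4) using left_mult_one_mat[OF mult_carrier_mat[OF F T(1)]] by simp
  qed
  obtain A B C D where bP: "P = four_block_mat A B C D" and cP: "A \<in> carrier_mat a a"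
    "B \<in> carrier_mat a s" "C \<in> carrier_mat s a" "D \<in> carrier_mat s s"
    using P(1) by (rule four_block_mat_cases) blast
  obtain A' B' C' D' where bP': "P' = four_block_mat A' B' C' D'" and cP': "A' \<in> carrier_mat a a"
    "B' \<in> carrier_mat a s" "C' \<in> carrier_mat s a" "D' \<in> carrier_mat s s"
    using P(2) by (rule four_block_mat_cases) blast
  obtain K L M N where bT: "T = four_block_mat K L M N" and cT: "K \<in> carrier_mat b b"
    "L \<in> carrier_mat b t" "M \<in> carrier_mat t b" "N \<in> carrier_mat t t"
    using T(1) by (rule four_block_mat_cases) blast
  obtain K' L' M' N' where bT': "T' = four_block_mat K' L' M' N'" and cT': "K' \<in> carrier_mat b b"
    "L' \<in> carrier_mat b t" "M' \<in> carrier_mat t b" "N' \<in> carrier_mat t t"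
    using T(2) by (rule four_block_mat_cases) blast
  have "D * d v = d v * N'" for v
    using dsum_intertwine(4)[OF f g d cP cT'] eq1[unfolded bP bT'] by blast
  from brick[OF cP(4) cT'(4) this] obtain c where c: "D = c \<cdot>\<^sub>m 1\<^sub>m s" "N' = c \<cdot>\<^sub>m 1\<^sub>m t" by blast
  \<comment> \<open>The inverse isomorphism consists of \<open>P'\<close> on the rows and
    \<open>T\<close> on the columns by \<open>eq2\<close>, so \<open>X\<close> and \<open>Y\<close>
    come from these two. The scalar blocks \<open>D\<close> and \<open>N'\<close> belong to their
    inverses \<open>P\<close> and \<open>T'\<close> and share the same \<open>c\<close>, so the
    cases for \<open>X\<close> and \<open>Y\<close> agree.\<close>
  define X where "X = (if c = 0 then A' - B' * C' else A')"
  define Y where "Y = (if c = 0 then K - L * M else K)"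
  have X: "nonsingular a X" unfolding X_def
    using nonsingular_corner[OF cP(1-3) cP'] P(3) unfolding bP bP' c by blast
  have Y: "nonsingular b Y" unfolding Y_def
    using nonsingular_corner[OF cT'(1-3) cT] T(4) unfolding bT bT' c by blast
  have XY: "X * g v = f v * Y" for v
  proof -
    note e = dsum_intertwine[OF g f d cP' cT eq2[unfolded bP' bT], of v]
    \<comment> \<open>The correction is the composite of the morphisms from \<open>g\<close> to
      \<open>d\<close> and from \<open>d\<close> to \<open>f\<close>; its row part is
      \<open>B' * C'\<close> and its column part is \<open>L * M\<close>.\<close>
    have "(B' * C') * g v = B' * (d v * M)"
      unfolding e(3)[symmetric] by (rule assoc_mult_mat[OF cP'(2,3) g])
    also have "\<dots> = (f v * L) * M"
      unfolding e(2)[symmetric] by (rule assoc_mult_mat[OF cP'(2) d cT(3), symmetric])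
    also have "\<dots> = f v * (L * M)" by (rule assoc_mult_mat[OF f cT(2,3)])
    finally have "(A' - B' * C') * g v = f v * (K - L * M)"
      using minus_mult_distrib_mat[OF cP'(1) mult_carrier_mat[OF cP'(2,3)] g]
        mult_minus_distrib_mat[OF f cT(1) mult_carrier_mat[OF cT(2,3)]] e(1) by simp
    then show ?thesis unfolding X_def Y_def using e(1) by simp
  qed
  obtain Y' where Y': "Y \<in> carrier_mat b b" "Y' \<in> carrier_mat b b" "nonsingular b Y'" "Y * Y' = 1\<^sub>m b"
    using Y by (rule nonsingularE) blast
  have "f v = X * g v * Y'" for v
    unfolding XY using assoc_mult_mat[OF f Y'(1,2)] right_mult_one_mat[OF f] Y'(4) by simp
  then have "pencil_equiv a b g f" using X Y' unfolding pencil_equiv_def by blast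
  then show ?thesis using pencil_equiv_sym g by blast
qed

subsection \<open>Arrays as pencils\<close>

definition act :: "nat \<Rightarrow> 'a :: comm_ring_1 mat \<Rightarrow> (nat \<Rightarrow> 'a) \<Rightarrow> nat \<Rightarrow> 'a" where
  "act d U v = (\<lambda>c. \<Sum>c'<d. U $$ (c, c') * v c')"

definition pencil :: "nat \<Rightarrow> nat \<Rightarrow> nat \<Rightarrow> 'a :: comm_ring_1 array3 \<Rightarrow> (nat \<Rightarrow> 'a) \<Rightarrow> 'a mat" where
  "pencil m n t F v = mat m n (\<lambda>(i, j). \<Sum>k<t. v k * F i j k)"

lemma pencil_carrier [simp]: "pencil m n t F v \<in> carrier_mat m n"
  by (simp add: pencil_def)

lemma transpose_mult_mult_index:
  fixes X :: "'a :: comm_ring_1 mat"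
  assumes "R \<in> carrier_mat m m" "X \<in> carrier_mat m n" "S \<in> carrier_mat n n" "i' < m" "j' < n"
  shows "(transpose_mat R * X * S) $$ (i', j') =
    (\<Sum>i<m. \<Sum>j<n. X $$ (i, j) * R $$ (i, i') * S $$ (j, j'))"
  using assms by (simp add: scalar_prod_def atLeast0LessThan sum_distrib_left mult_ac)

text \<open>Contracting the third index with \<open>v\<close> turns \<open>U\<close> into the
  substitution of \<open>act t U v\<close> for \<open>v\<close>. The matrix \<open>R\<close> enters
  transposed because \<open>transforms\<close> sums over its row index. Conversely, the pencil at a
  unit vector is a slice of the array.\<close>

lemma transforms_iff_pencil:
  fixes R :: "'a :: field mat"
  assumes R: "R \<in> carrier_mat m m" and S: "S \<in> carrier_mat n n"
  shows "transforms m n t R S U F G \<longleftrightarrow>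
    (\<forall>v. pencil m n t G v = transpose_mat R * pencil m n t F (act t U v) * S)"
proof -
  have entry: "(transpose_mat R * pencil m n t F (act t U v) * S) $$ (i', j') =
      (\<Sum>k'<t. v k' * (\<Sum>i<m. \<Sum>j<n. \<Sum>k<t. F i j k * R $$ (i, i') * S $$ (j, j') * U $$ (k, k')))"
    if "i' < m" "j' < n" for v i' j'
  proof -
    have "(transpose_mat R * pencil m n t F (act t U v) * S) $$ (i', j') =
      (\<Sum>i<m. \<Sum>j<n. (\<Sum>k<t. (\<Sum>k'<t. U $$ (k, k') * v k') * F i j k) * R $$ (i, i') * S $$ (j, j'))"
      using that by (subst transpose_mult_mult_index[OF R _ S]) (auto simp: pencil_def act_def)
    also have "\<dots> = (\<Sum>i<m. \<Sum>j<n. \<Sum>k<t. \<Sum>k'<t.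
        v k' * (F i j k * R $$ (i, i') * S $$ (j, j') * U $$ (k, k')))"
      by (simp add: sum_distrib_left sum_distrib_right mult_ac)
    also have "\<dots> = (\<Sum>i<m. \<Sum>j<n. \<Sum>k'<t. \<Sum>k<t.
        v k' * (F i j k * R $$ (i, i') * S $$ (j, j') * U $$ (k, k')))"
      by (intro sum.cong refl sum.swap)
    also have "\<dots> = (\<Sum>i<m. \<Sum>k'<t. \<Sum>j<n. \<Sum>k<t.
        v k' * (F i j k * R $$ (i, i') * S $$ (j, j') * U $$ (k, k')))"
      by (intro sum.cong refl sum.swap)
    also have "\<dots> = (\<Sum>k'<t. \<Sum>i<m. \<Sum>j<n. \<Sum>k<t.
        v k' * (F i j k * R $$ (i, i') * S $$ (j, j') * U $$ (k, k')))"
      by (rule sum.swap)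
    finally show ?thesis by (simp add: sum_distrib_left)
  qed
  show ?thesis
  proof
    assume "transforms m n t R S U F G"
    then show "\<forall>v. pencil m n t G v = transpose_mat R * pencil m n t F (act t U v) * S"
      using R S by (auto intro!: eq_matI simp del: index_mult_mat(1)
        simp: entry) (auto simp: pencil_def transforms_def)
  next
    assume eq: "\<forall>v. pencil m n t G v = transpose_mat R * pencil m n t F (act t U v) * S"
    show "transforms m n t R S U F G"
      unfolding transforms_def
    proof (intro allI impI)
      fix i' j' k' assume lt: "i' < m" "j' < n" "k' < t"
      let ?e = "\<lambda>k. if k = k' then 1 else 0 :: 'a"
      have "G i' j' k' = pencil m n t G ?e $$ (i', j')"
        using lt by (simp add: pencil_def if_distrib[of "\<lambda>x. x * _"] cong: if_cong)
      also have "\<dots> = (\<Sum>i<m. \<Sum>j<n. \<Sum>k<t. F i j k * R $$ (i, i') * S $$ (j, j') * U $$ (k, k'))"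
        unfolding eq[rule_format, of ?e] entry[OF lt(1,2)]
        using lt by (simp add: if_distrib[of "\<lambda>x. x * _"] cong: if_cong)
      finally show "G i' j' k' = (\<Sum>i<m. \<Sum>j<n. \<Sum>k<t. F i j k * R $$ (i, i') * S $$ (j, j') * U $$ (k, k'))" .
    qed
  qed
qed

text \<open>The matrix \<open>U\<close> stays outside the quantifier: arbitrary equivalence and
  simultaneous equivalence will differ only in the shape allowed for it.\<close>

lemma transforms_iff_pencil_equiv:
  "(\<exists>R S. nonsingular m R \<and> nonsingular n S \<and> transforms m n t R S U F G) \<longleftrightarrow>
    pencil_equiv m n (\<lambda>v. pencil m n t F (act t U v)) (pencil m n t G)"
  (is "?l \<longleftrightarrow> ?r")
proof
  assume ?l
  then obtain R S where "nonsingular m R" "nonsingular n S" "transforms m n t R S U F G" by blast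
  moreover from this have "pencil m n t G v = transpose_mat R * pencil m n t F (act t U v) * S" for v
    using transforms_iff_pencil[of R m S n] by (simp add: nonsingular_def)
  ultimately show ?r using nonsingular_transpose unfolding pencil_equiv_def by blast
next
  assume ?r
  then obtain P S where PS: "nonsingular m P" "nonsingular n S"
    "\<forall>v. pencil m n t G v = transpose_mat (transpose_mat P) * pencil m n t F (act t U v) * S"
    unfolding pencil_equiv_def by auto
  have "P \<in> carrier_mat m m" "S \<in> carrier_mat n n" using PS by (auto simp: nonsingular_def)
  then have "transforms m n t (transpose_mat P) S U F G"
    using PS(3) by (subst transforms_iff_pencil) auto
  then show ?l using PS nonsingular_transpose by blast
qed

lemma equivalent3_iff_pencil_equiv:
  "equivalent3 m n t F G \<longleftrightarrow>
    (\<exists>U. nonsingular t U \<and> pencil_equiv m n (\<lambda>v. pencil m n t F (act t U v)) (pencil m n t G))"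
  unfolding equivalent3_def transforms_iff_pencil_equiv[symmetric] by blast

section \<open>Third indices in \<open>p\<close> blocks of length \<open>t\<close>, and matrices
  acting equally on all blocks\<close>

lemma block_index_less:
  fixes l k p t :: nat
  assumes "l < p" "k < t"
  shows "l * t + k < p * t"
proof -
  have "l * t + k < Suc l * t" using assms by simp
  also have "\<dots> \<le> p * t" using assms by (intro mult_le_mono) auto
  finally show ?thesis .
qed

lemma block_index_eq_iff:
  fixes l k l' k' t :: nat
  assumes "k < t" "k' < t"
  shows "l' * t + k' = l * t + k \<longleftrightarrow> l' = l \<and> k' = k"
proof
  assume eq: "l' * t + k' = l * t + k"
  have "(l' * t + k') div t = l'" "(l' * t + k') mod t = k'" "(l * t + k) div t = l" "(l * t + k) mod t = k"
    using assms by auto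
  then show "l' = l \<and> k' = k" unfolding eq by blast
qed simp

lemma sum_div_mod:
  fixes f :: "nat \<Rightarrow> nat \<Rightarrow> 'a :: comm_monoid_add"
  assumes "t > 0"
  shows "(\<Sum>c<p * t. f (c div t) (c mod t)) = (\<Sum>l<p. \<Sum>k<t. f l k)"
  unfolding sum.cartesian_product
  by (rule sum.reindex_bij_witness[of _ "\<lambda>(l, k). l * t + k" "\<lambda>c. (c div t, c mod t)"])
     (use assms in \<open>auto simp: block_index_less less_mult_imp_div_less\<close>)

lemma sum_single_block:
  fixes f :: "nat \<Rightarrow> 'a :: comm_monoid_add"
  assumes "l < p" "t > 0"
  shows "(\<Sum>c<p * t. if c div t = l then f (c mod t) else 0) = (\<Sum>k<t. f k)"
proof -
  have "(\<Sum>c<p * t. if c div t = l then f (c mod t) else 0)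
      = (\<Sum>l'<p. \<Sum>k<t. if l' = l then f k else 0)"
    by (rule sum_div_mod[OF assms(2), where f = "\<lambda>l' k. if l' = l then f k else 0"])
  also have "\<dots> = (\<Sum>l'<p. if l' = l then \<Sum>k<t. f k else 0)"
    by (intro sum.cong) auto
  finally show ?thesis using assms by simp
qed

text \<open>The Kronecker product of the identity of size \<open>p\<close> with \<open>U\<close>:
  the index \<open>c\<close> is the position \<open>c mod t\<close> in the block
  \<open>c div t\<close>.\<close>

definition diag_copies :: "nat \<Rightarrow> nat \<Rightarrow> 'a :: zero mat \<Rightarrow> 'a mat" where
  "diag_copies p t U = mat (p * t) (p * t)
    (\<lambda>(c, c'). if c div t = c' div t then U $$ (c mod t, c' mod t) else 0)"

lemma diag_copies_carrier [simp]: "diag_copies p t U \<in> carrier_mat (p * t) (p * t)"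
  by (simp add: diag_copies_def)

lemma diag_copies_one:
  assumes "t > 0"
  shows "diag_copies p t (1\<^sub>m t) = 1\<^sub>m (p * t)"
proof (rule eq_matI)
  fix c c' assume "c < dim_row (1\<^sub>m (p * t) :: 'a mat)" "c' < dim_col (1\<^sub>m (p * t) :: 'a mat)"
  moreover have "c = c' \<longleftrightarrow> c div t = c' div t \<and> c mod t = c' mod t"
    by (metis div_mult_mod_eq)
  ultimately show "diag_copies p t (1\<^sub>m t) $$ (c, c') = 1\<^sub>m (p * t) $$ (c, c')"
    using assms by (auto simp: diag_copies_def)
qed (auto simp: diag_copies_def)

lemma diag_copies_mult:
  fixes U V :: "'a :: comm_ring_1 mat"
  assumes "t > 0" "U \<in> carrier_mat t t" "V \<in> carrier_mat t t"
  shows "diag_copies p t U * diag_copies p t V = diag_copies p t (U * V)"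
proof (rule eq_matI)
  fix c c' assume "c < dim_row (diag_copies p t (U * V))" "c' < dim_col (diag_copies p t (U * V))"
  then have lt: "c < p * t" "c' < p * t" by (auto simp: diag_copies_def)
  then have l: "c div t < p" by (simp add: less_mult_imp_div_less)
  have "(diag_copies p t U * diag_copies p t V) $$ (c, c')
      = (\<Sum>x<p * t. diag_copies p t U $$ (c, x) * diag_copies p t V $$ (x, c'))"
    using lt by (simp add: scalar_prod_def atLeast0LessThan diag_copies_def)
  also have "\<dots> = (\<Sum>x<p * t. if x div t = c div t then
      (if c div t = c' div t then U $$ (c mod t, x mod t) * V $$ (x mod t, c' mod t) else 0) else 0)"
    using lt by (intro sum.cong) (auto simp: diag_copies_def)
  also have "\<dots> = (\<Sum>k<t. if c div t = c' div t then U $$ (c mod t, k) * V $$ (k, c' mod t) else 0)"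
    by (rule sum_single_block[OF l assms(1), where
      f = "\<lambda>k. if c div t = c' div t then U $$ (c mod t, k) * V $$ (k, c' mod t) else 0"])
  also have "\<dots> = diag_copies p t (U * V) $$ (c, c')"
    using lt assms by (auto simp: diag_copies_def scalar_prod_def atLeast0LessThan)
  finally show "(diag_copies p t U * diag_copies p t V) $$ (c, c') = diag_copies p t (U * V) $$ (c, c')" .
qed (auto simp: diag_copies_def)

lemma nonsingular_diag_copies:
  assumes "t > 0" "nonsingular t U"
  shows "nonsingular (p * t) (diag_copies p t U)"
proof -
  obtain U' where U: "U \<in> carrier_mat t t" "U' \<in> carrier_mat t t" "U * U' = 1\<^sub>m t"
    using assms(2) by (rule nonsingularE) blast
  show ?thesis
    by (rule nonsingularI[of _ _ "diag_copies p t U'"])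
       (use diag_copies_mult[OF assms(1) U(1,2)] U(3) diag_copies_one[OF assms(1)] in auto)
qed

text \<open>The first \<open>t\<close> rows of \<open>diag_copies p t U\<close> vanish outside the
  first \<open>t\<close> columns, so the upper left block of its inverse inverts \<open>U\<close>.
  This block exists because \<open>p\<close> is positive.\<close>

lemma nonsingular_of_diag_copies:
  fixes U :: "'a :: field mat"
  assumes "p > 0" "t > 0" "U \<in> carrier_mat t t" "nonsingular (p * t) (diag_copies p t U)"
  shows "nonsingular t U"
proof -
  obtain W where W: "W \<in> carrier_mat (p * t) (p * t)" "diag_copies p t U * W = 1\<^sub>m (p * t)"
    using assms(4) by (rule nonsingularE) blast
  define V where "V = mat t t (\<lambda>(k, k'). W $$ (k, k'))"
  have tp: "t \<le> p * t" using assms by simp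
  have "U * V = 1\<^sub>m t"
  proof (rule eq_matI)
    fix c c' assume "c < dim_row (1\<^sub>m t :: 'a mat)" "c' < dim_col (1\<^sub>m t :: 'a mat)"
    then have lt: "c < t" "c' < t" by auto
    then have lt': "c < p * t" "c' < p * t" using tp by (auto elim: order.strict_trans2)
    have "(U * V) $$ (c, c') = (\<Sum>k<t. U $$ (c, k) * W $$ (k, c'))"
      using lt assms(3) by (simp add: scalar_prod_def atLeast0LessThan V_def)
    also have "\<dots> = (\<Sum>x<p * t. if x div t = 0 then U $$ (c, x mod t) * W $$ (x mod t, c') else 0)"
      by (rule sum_single_block[OF assms(1,2), symmetric])
    also have "\<dots> = (\<Sum>x<p * t. diag_copies p t U $$ (c, x) * W $$ (x, c'))"
      using lt lt' assms(2) by (intro sum.cong) (auto simp: diag_copies_def div_eq_0_iff)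
    also have "\<dots> = (diag_copies p t U * W) $$ (c, c')"
      using lt' W(1) by (simp add: scalar_prod_def atLeast0LessThan diag_copies_def)
    finally show "(U * V) $$ (c, c') = 1\<^sub>m t $$ (c, c')" using W(2) lt lt' by simp
  qed (use assms in \<open>auto simp: V_def\<close>)
  then show ?thesis using assms(3) by (intro nonsingularI[of _ _ V]) (auto simp: V_def)
qed

lemma act_diag_copies:
  fixes U :: "'a :: comm_ring_1 mat"
  assumes "l < p" "k < t"
  shows "act (p * t) (diag_copies p t U) v (l * t + k) = (\<Sum>k'<t. U $$ (k, k') * v (l * t + k'))"
proof -
  have "act (p * t) (diag_copies p t U) v (l * t + k)
      = (\<Sum>c<p * t. if c div t = l then U $$ (k, c mod t) * v (l * t + c mod t) else 0)"
    unfolding act_def using block_index_less[OF assms] assms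
    by (intro sum.cong) (auto simp: diag_copies_def)
  also have "\<dots> = (\<Sum>k'<t. U $$ (k, k') * v (l * t + k'))"
    using assms by (intro sum_single_block[where f = "\<lambda>k'. U $$ (k, k') * v (l * t + k')"]) auto
  finally show ?thesis .
qed

definition concat_array :: "nat \<Rightarrow> (nat \<Rightarrow> 'a array3) \<Rightarrow> 'a array3" where
  "concat_array t A = (\<lambda>i j c. A (c div t) i j (c mod t))"

text \<open>A block diagonal third matrix does not mix the slices of different arrays, and its equal
  diagonal blocks apply the same \<open>U\<close> to each array.\<close>

lemma transforms_concat_array:
  fixes U :: "'a :: field mat"
  assumes "t > 0"
  shows "transforms m n (p * t) R S (diag_copies p t U) (concat_array t A) (concat_array t B) \<longleftrightarrow>
    (\<forall>l<p. transforms m n t R S U (A l) (B l))"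
proof -
  have entry: "(\<Sum>c<p * t. concat_array t A i j c * R $$ (i, i') * S $$ (j, j') * diag_copies p t U $$ (c, l * t + k'))
      = (\<Sum>k<t. A l i j k * R $$ (i, i') * S $$ (j, j') * U $$ (k, k'))"
    if "l < p" "k' < t" for i j i' j' k' l
  proof -
    have "(\<Sum>c<p * t. concat_array t A i j c * R $$ (i, i') * S $$ (j, j') * diag_copies p t U $$ (c, l * t + k'))
      = (\<Sum>c<p * t. if c div t = l then
          A l i j (c mod t) * R $$ (i, i') * S $$ (j, j') * U $$ (c mod t, k') else 0)"
      using that block_index_less[OF that] by (intro sum.cong) (auto simp: diag_copies_def concat_array_def)
    also have "\<dots> = (\<Sum>k<t. A l i j k * R $$ (i, i') * S $$ (j, j') * U $$ (k, k'))"
      using that by (intro sum_single_block[where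
        f = "\<lambda>k. A l i j k * R $$ (i, i') * S $$ (j, j') * U $$ (k, k')"]) auto
    finally show ?thesis .
  qed
  have split: "(\<forall>c<p * t. Q c) \<longleftrightarrow> (\<forall>l<p. \<forall>k<t. Q (l * t + k))" for Q
  proof (intro iffI allI impI)
    fix c assume "\<forall>l<p. \<forall>k<t. Q (l * t + k)" "c < p * t"
    then have "\<forall>k<t. Q (c div t * t + k)" using less_mult_imp_div_less[of c p t] by blast
    then have "Q (c div t * t + c mod t)" using assms by (blast intro: mod_less_divisor)
    then show "Q c" unfolding div_mult_mod_eq .
  qed (auto simp: block_index_less)
  have "transforms m n (p * t) R S (diag_copies p t U) (concat_array t A) (concat_array t B) \<longleftrightarrow>
    (\<forall>i'<m. \<forall>j'<n. \<forall>l<p. \<forall>k'<t. B l i' j' k' =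
      (\<Sum>i<m. \<Sum>j<n. \<Sum>k<t. A l i j k * R $$ (i, i') * S $$ (j, j') * U $$ (k, k')))"
    unfolding transforms_def split by (auto simp: entry) (auto simp: concat_array_def)
  then show ?thesis unfolding transforms_def by blast
qed

text \<open>Compared with \<open>equivalent3_iff_pencil_equiv\<close> for the concatenated arrays,
  only the shape of the third matrix is restricted. Forcing this shape is the purpose of the
  bricks.\<close>

lemma simultaneously_equivalent3_iff_pencil_equiv:
  fixes A B :: "nat \<Rightarrow> 'a :: field array3"
  assumes "t > 0"
  shows "simultaneously_equivalent3 p m n t A B \<longleftrightarrow>
    (\<exists>U. nonsingular t U \<and>
      pencil_equiv m n (\<lambda>v. pencil m n (p * t) (concat_array t A) (act (p * t) (diag_copies p t U) v))
        (pencil m n (p * t) (concat_array t B)))"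
  unfolding simultaneously_equivalent3_def transforms_iff_pencil_equiv[symmetric]
    transforms_concat_array[OF assms] by blast

subsection \<open>Bricks\<close>

text \<open>The sum of the blocks of \<open>v\<close> numbered by \<open>S\<close>, as a column. It
  is written as one sum over the flat index because the contraction of the encoding array has this
  form; \<open>brick_index\<close> gives the sum over blocks.\<close>

definition brick :: "nat \<Rightarrow> nat \<Rightarrow> nat set \<Rightarrow> (nat \<Rightarrow> 'a :: comm_ring_1) \<Rightarrow> 'a mat" where
  "brick p t S v = mat t 1 (\<lambda>(k, _). \<Sum>c<p * t. if c mod t = k \<and> c div t \<in> S then v c else 0)"

lemma brick_carrier [simp]: "brick p t S v \<in> carrier_mat t 1"
  by (simp add: brick_def)

lemma brick_index:
  assumes "k < t"
  shows "brick p t S v $$ (k, 0) = (\<Sum>l<p. if l \<in> S then v (l * t + k) else 0)"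
proof -
  have "brick p t S v $$ (k, 0) = (\<Sum>c<p * t. if c mod t = k \<and> c div t \<in> S then v (c div t * t + c mod t) else 0)"
    using assms unfolding div_mult_mod_eq by (simp add: brick_def)
  also have "\<dots> = (\<Sum>l<p. \<Sum>k'<t. if k' = k \<and> l \<in> S then v (l * t + k') else 0)"
    using assms by (intro sum_div_mod[where f = "\<lambda>l k'. if k' = k \<and> l \<in> S then v (l * t + k') else 0"]) auto
  also have "\<dots> = (\<Sum>l<p. if l \<in> S then v (l * t + k) else 0)"
    using assms by (intro sum.cong) auto
  finally show ?thesis .
qed

lemma brick_eq_0_iff: "brick p t S v = 0\<^sub>m t 1 \<longleftrightarrow> (\<forall>k<t. brick p t S v $$ (k, 0) = 0)"
  by (auto intro!: eq_matI) (auto simp: brick_def)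

text \<open>Applying the same \<open>U\<close> to every block commutes with summing blocks. So on a
  brick the action on the parameter amounts to a row transformation.\<close>

lemma brick_act_diag_copies:
  assumes U: "U \<in> carrier_mat t t"
  shows "brick p t S (act (p * t) (diag_copies p t U) v) = U * brick p t S v"
proof (rule eq_matI)
  fix k j assume "k < dim_row (U * brick p t S v)" "j < dim_col (U * brick p t S v)"
  then have k: "k < t" and j: "j = 0" using U by (auto simp: brick_def)
  have "brick p t S (act (p * t) (diag_copies p t U) v) $$ (k, 0)
      = (\<Sum>l<p. if l \<in> S then \<Sum>k'<t. U $$ (k, k') * v (l * t + k') else 0)"
    unfolding brick_index[OF k] using k by (intro sum.cong) (auto simp: act_diag_copies)
  also have "\<dots> = (\<Sum>l<p. \<Sum>k'<t. U $$ (k, k') * (if l \<in> S then v (l * t + k') else 0))"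
    by (intro sum.cong) auto
  also have "\<dots> = (\<Sum>k'<t. \<Sum>l<p. U $$ (k, k') * (if l \<in> S then v (l * t + k') else 0))"
    by (rule sum.swap)
  also have "\<dots> = (\<Sum>k'<t. U $$ (k, k') * brick p t S v $$ (k', 0))"
    by (intro sum.cong refl) (simp add: brick_index sum_distrib_left)
  also have "\<dots> = (U * brick p t S v) $$ (k, 0)"
    using k U carrier_matD[OF brick_carrier[of p t S v]]
    by (simp add: scalar_prod_def atLeast0LessThan)
  finally show "brick p t S (act (p * t) (diag_copies p t U) v) $$ (k, j) = (U * brick p t S v) $$ (k, j)"
    using j by simp
qed (use U in \<open>auto simp: brick_def\<close>)

text \<open>Taking \<open>v\<close> to be a unit vector in the block \<open>l\<close> of
  \<open>S\<close>, the brick becomes an arbitrary unit column. Hence every unit column is an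
  eigenvector of \<open>X\<close>, always with the single entry of \<open>Y\<close> as
  eigenvalue.\<close>

lemma brick_endomorphism_scalar:
  fixes X Y :: "'a :: field mat"
  assumes l: "l < p" "l \<in> S" and X: "X \<in> carrier_mat t t" and Y: "Y \<in> carrier_mat 1 1"
    and eq: "\<And>v. X * brick p t S v = brick p t S v * Y"
  shows "\<exists>c. X = c \<cdot>\<^sub>m 1\<^sub>m t \<and> Y = c \<cdot>\<^sub>m 1\<^sub>m 1"
proof (intro exI conjI)
  let ?c = "Y $$ (0, 0)"
  show "Y = ?c \<cdot>\<^sub>m 1\<^sub>m 1" using Y by (intro eq_matI) auto
  show "X = ?c \<cdot>\<^sub>m 1\<^sub>m t"
  proof (rule eq_matI)
    fix i k assume "i < dim_row (?c \<cdot>\<^sub>m 1\<^sub>m t)" "k < dim_col (?c \<cdot>\<^sub>m 1\<^sub>m t)"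
    then have lt: "i < t" "k < t" by auto
    let ?e = "\<lambda>c. if c = l * t + k then 1 else 0 :: 'a"
    have b: "brick p t S ?e $$ (k', 0) = (if k' = k then 1 else 0)" if "k' < t" for k'
    proof -
      have "l' * t + k' = l * t + k \<longleftrightarrow> l' = l \<and> k' = k" for l'
        using that lt by (simp add: block_index_eq_iff)
      then have "brick p t S ?e $$ (k', 0) = (\<Sum>l'<p. if l' = l then (if k' = k then 1 else 0) else 0)"
        unfolding brick_index[OF that] using l by (intro sum.cong) auto
      then show ?thesis using l by simp
    qed
    have d: "dim_row (brick p t S ?e) = t" "dim_col (brick p t S ?e) = 1"
      by (simp_all add: brick_def)
    have "X $$ (i, k) = (\<Sum>k'<t. X $$ (i, k') * (if k' = k then 1 else 0))"
      using lt by (simp add: if_distrib[of "\<lambda>x. _ * x"] cong: if_cong)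
    also have "\<dots> = (X * brick p t S ?e) $$ (i, 0)"
      using lt X d b by (simp add: scalar_prod_def atLeast0LessThan)
    also have "\<dots> = brick p t S ?e $$ (i, 0) * ?c"
      unfolding eq using lt Y d by (simp add: scalar_prod_def)
    finally show "X $$ (i, k) = (?c \<cdot>\<^sub>m 1\<^sub>m t) $$ (i, k)" using lt b[of i] by simp
  qed (use X in auto)
qed

text \<open>The sets with \<open>l = l'\<close> make the off-diagonal blocks vanish, those with \<open>l \<noteq> l'\<close> identify the
  diagonal blocks.\<close>

lemma diag_copies_of_bricks_preserved:
  fixes U :: "'a :: field mat"
  assumes "p > 0" and U: "U \<in> carrier_mat (p * t) (p * t)"
    and pres: "\<And>l l' v. l < p \<Longrightarrow> l' < p \<Longrightarrow> brick p t {l, l'} v = 0\<^sub>m t 1 \<Longrightarrow>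
      brick p t {l, l'} (act (p * t) U v) = 0\<^sub>m t 1"
  obtains U0 where "U0 \<in> carrier_mat t t" "U = diag_copies p t U0"
proof -
  \<comment> \<open>\<open>{l, l}\<close> is a one-element set, so its brick is the block
    \<open>l\<close> itself and not twice this block; this matters in characteristic two.\<close>
  have b1: "brick p t {l, l} v $$ (k, 0) = v (l * t + k)" if "l < p" "k < t" for l k and v :: "nat \<Rightarrow> 'a"
    using that by (simp add: brick_index)
  have b2: "brick p t {l, l'} v $$ (k, 0) = v (l * t + k) + v (l' * t + k)"
    if "l < p" "l' < p" "k < t" "l \<noteq> l'" for l l' k and v :: "nat \<Rightarrow> 'a"
  proof -
    have "brick p t {l, l'} v $$ (k, 0) = (\<Sum>x<p. (if x = l then v (l * t + k) else 0) + (if x = l' then v (l' * t + k) else 0))"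
      unfolding brick_index[OF that(3)] using that by (intro sum.cong) auto
    then show ?thesis using that by (simp add: sum.distrib)
  qed
  have off: "U $$ (l * t + k, l' * t + k') = 0" if "l < p" "l' < p" "k < t" "k' < t" "l \<noteq> l'" for l l' k k'
  proof -
    let ?e = "\<lambda>c. if c = l' * t + k' then 1 else 0 :: 'a"
    have "brick p t {l, l} ?e = 0\<^sub>m t 1"
      unfolding brick_eq_0_iff using that by (auto simp: b1 block_index_eq_iff simp del: insert_absorb2)
    from pres[OF that(1,1) this] have "act (p * t) U ?e (l * t + k) = 0"
      using that b1[of l k "act (p * t) U ?e"] by simp
    then show ?thesis using block_index_less[of l' p k' t] that
      by (simp add: act_def if_distrib[of "\<lambda>x. _ * x"] cong: if_cong)
  qed
  have same: "U $$ (l * t + k, l * t + k') = U $$ (k, k')" if "l < p" "k < t" "k' < t" for l k k'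
  proof (cases "l = 0")
    case False
    \<comment> \<open>The blocks \<open>l\<close> and \<open>0\<close> of \<open>?e\<close> are
      opposite, so their sum vanishes. It still vanishes after applying \<open>U\<close>, which, the
      off-diagonal blocks being zero, compares the diagonal blocks \<open>l\<close> and
      \<open>0\<close>.\<close>
    let ?e = "\<lambda>c. (if c = l * t + k' then 1 else 0) - (if c = 0 * t + k' then 1 else 0) :: 'a"
    have "brick p t {l, 0} ?e $$ (k'', 0) = 0" if "k'' < t" for k''
    proof -
      have "brick p t {l, 0} ?e $$ (k'', 0) = ?e (l * t + k'') + ?e (0 * t + k'')"
        using that \<open>l < p\<close> \<open>p > 0\<close> False by (intro b2) auto
      moreover have "l * t + k'' \<noteq> k'" "k'' \<noteq> l * t + k'"
        using block_index_eq_iff[of k' t k'' l 0] block_index_eq_iff[of k' t k'' 0 l] that \<open>k' < t\<close> False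
        by auto
      ultimately show ?thesis by simp
    qed
    then have "brick p t {l, 0} ?e = 0\<^sub>m t 1" unfolding brick_eq_0_iff by blast
    from pres[OF \<open>l < p\<close> \<open>p > 0\<close> this]
    have "act (p * t) U ?e (l * t + k) + act (p * t) U ?e (0 * t + k) = 0"
      using that b2[OF \<open>l < p\<close> \<open>p > 0\<close> \<open>k < t\<close> False, of "act (p * t) U ?e"] by simp
    moreover have "act (p * t) U ?e c = U $$ (c, l * t + k') - U $$ (c, 0 * t + k')" for c
      using block_index_less[OF \<open>l < p\<close> \<open>k' < t\<close>] block_index_less[OF \<open>p > 0\<close> \<open>k' < t\<close>]
      by (simp add: act_def right_diff_distrib sum_subtractf if_distrib[of "\<lambda>x. _ * x"] cong: if_cong)
    ultimately show ?thesis
      using off[of l 0 k k'] off[of 0 l k k'] that \<open>p > 0\<close> False by simp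
  qed simp
  define U0 where "U0 = mat t t (\<lambda>(k, k'). U $$ (k, k'))"
  have "U = diag_copies p t U0"
  proof (rule eq_matI)
    fix c c' assume "c < dim_row (diag_copies p t U0)" "c' < dim_col (diag_copies p t U0)"
    then have lt: "c < p * t" "c' < p * t" by (simp_all add: diag_copies_def)
    have t: "t > 0" by (rule gr0I) (use lt in simp)
    have l: "c div t < p" "c' div t < p" "c mod t < t" "c' mod t < t"
      using lt t by (simp_all add: less_mult_imp_div_less)
    have "U $$ (c, c') = U $$ (c div t * t + c mod t, c' div t * t + c' mod t)"
      unfolding div_mult_mod_eq ..
    also have "\<dots> = (if c div t = c' div t then U $$ (c mod t, c' mod t) else 0)"
    proof (cases "c div t = c' div t")
      case True
      show ?thesis unfolding True[symmetric] same[OF l(1,3,4)] by simp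
    next
      case False
      show ?thesis unfolding off[OF l False] using False by simp
    qed
    finally show "U $$ (c, c') = diag_copies p t U0 $$ (c, c')"
      using lt l by (simp add: diag_copies_def U0_def)
  qed (use U in \<open>auto simp: diag_copies_def\<close>)
  then show thesis by (rule that[rotated]) (simp add: U0_def)
qed

section \<open>Direct sums of a pencil with bricks\<close>

primrec add_bricks :: "(nat \<Rightarrow> 'b \<Rightarrow> 'a :: zero mat) \<Rightarrow> ('b \<Rightarrow> 'a mat) \<Rightarrow> nat \<Rightarrow> 'b \<Rightarrow> 'a mat" where
  "add_bricks d f 0 v = f v"
| "add_bricks d f (Suc q) v = dsum_mat (add_bricks d f q v) (d q v)"

lemma add_bricks_carrier:
  assumes "f v \<in> carrier_mat m n" "\<And>q. d q v \<in> carrier_mat t 1"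
  shows "add_bricks d f q v \<in> carrier_mat (m + q * t) (n + q)"
proof (induction q)
  case (Suc q)
  have "add_bricks d f (Suc q) v \<in> carrier_mat ((m + q * t) + t) ((n + q) + 1)"
    using Suc assms(2)[of q] by auto
  then show ?case by (simp add: add_ac)
qed (use assms in simp)

lemma pencil_equiv_add_bricks:
  fixes f g :: "'b \<Rightarrow> 'a :: field mat"
  assumes f: "\<And>v. f v \<in> carrier_mat m n" and d: "\<And>q v. d q v \<in> carrier_mat t 1"
    and fg: "pencil_equiv m n f g" and de: "\<And>q. pencil_equiv t 1 (d q) (e q)"
  shows "pencil_equiv (m + q * t) (n + q) (add_bricks d f q) (add_bricks e g q)"
proof (induction q)
  case (Suc q)
  have "pencil_equiv ((m + q * t) + t) ((n + q) + 1)
      (\<lambda>v. dsum_mat (add_bricks d f q v) (d q v)) (\<lambda>v. dsum_mat (add_bricks e g q v) (e q v))"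
    by (rule pencil_equiv_dsum[OF _ d Suc de]) (rule add_bricks_carrier; use f d in blast)
  then show ?case by (simp add: add_ac pencil_equiv_def)
qed (use fg in \<open>simp add: pencil_equiv_def\<close>)

text \<open>The brick added last stands in the lower right corner, where
  \<open>pencil_equiv_cancel\<close> removes it; induction removes the others.\<close>

lemma pencil_equiv_cancel_bricks:
  fixes f g :: "'b \<Rightarrow> 'a :: field mat"
  assumes f: "\<And>v. f v \<in> carrier_mat m n" and g: "\<And>v. g v \<in> carrier_mat m n"
    and d: "\<And>q v. d q v \<in> carrier_mat t 1"
    and brick: "\<And>q X Y. q < Q \<Longrightarrow> X \<in> carrier_mat t t \<Longrightarrow> Y \<in> carrier_mat 1 1 \<Longrightarrow>
      (\<And>v. X * d q v = d q v * Y) \<Longrightarrow> \<exists>c. X = c \<cdot>\<^sub>m 1\<^sub>m t \<and> Y = c \<cdot>\<^sub>m 1\<^sub>m 1"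
    and equiv: "pencil_equiv (m + Q * t) (n + Q) (add_bricks d f Q) (add_bricks d g Q)"
  shows "pencil_equiv m n f g"
  using brick equiv
proof (induction Q)
  case 0
  then show ?case by (simp add: pencil_equiv_def)
next
  case (Suc Q)
  have equiv: "pencil_equiv ((m + Q * t) + t) ((n + Q) + 1)
      (\<lambda>v. dsum_mat (add_bricks d f Q v) (d Q v)) (\<lambda>v. dsum_mat (add_bricks d g Q v) (d Q v))"
    using Suc.prems(2) by (simp add: add_ac pencil_equiv_def)
  have "pencil_equiv (m + Q * t) (n + Q) (add_bricks d f Q) (add_bricks d g Q)"
  proof (rule pencil_equiv_cancel[OF _ _ d _ equiv])
    show "add_bricks d f Q v \<in> carrier_mat (m + Q * t) (n + Q)" for v
      by (rule add_bricks_carrier) (use f d in blast)+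
    show "add_bricks d g Q v \<in> carrier_mat (m + Q * t) (n + Q)" for v
      by (rule add_bricks_carrier) (use g d in blast)+
  qed (use Suc.prems(1)[of Q] in blast)
  then show ?case using Suc.IH Suc.prems(1) less_SucI by blast
qed

text \<open>The brick \<open>q\<close> occupies the \<open>t\<close> rows from
  \<open>m + q * t\<close> on and the single column \<open>n + q\<close>. This explicit form is what
  the entries of the encoding array are matched with.\<close>

lemma add_bricks_index:
  fixes f :: "'b \<Rightarrow> 'a :: field mat"
  assumes f: "f v \<in> carrier_mat m n" and d: "\<And>q. d q v \<in> carrier_mat t 1"
    and t: "t > 0" and "i < m + Q * t" "j < n + Q"
  shows "add_bricks d f Q v $$ (i, j) =
    (if i < m \<and> j < n then f v $$ (i, j)
     else if m \<le> i \<and> n \<le> j \<and> (i - m) div t = j - n then d (j - n) v $$ ((i - m) mod t, 0) else 0)"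
  using assms(4,5)
proof (induction Q arbitrary: i j)
  case (Suc Q)
  have c: "dim_row (add_bricks d f Q v) = m + Q * t" "dim_col (add_bricks d f Q v) = n + Q"
    "dim_row (d Q v) = t" "dim_col (d Q v) = 1"
    using add_bricks_carrier[of f v m n d t Q] f d by auto
  show ?case
  proof (cases "i < m + Q * t")
    case i: True
    then have "(i - m) div t \<noteq> Q" if "m \<le> i"
    proof -
      have "i - m < Q * t" using i that by linarith
      then show ?thesis using less_mult_imp_div_less by blast
    qed
    then show ?thesis using i Suc c by (cases "j < n + Q") (auto simp: not_less less_Suc_eq)
  next
    case False
    define k where "k = i - m - Q * t"
    have i: "i - m = Q * t + k" "k < t" "m \<le> i" "\<not> i < m" using False Suc.prems by (auto simp: k_def)
    have dm: "(i - m) div t = Q" "(i - m) mod t = k" unfolding i(1) using i(2) by auto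
    have k: "i - (m + Q * t) = k" by (simp add: k_def)
    show ?thesis
    proof (cases "j < n + Q")
      case True
      then have "Q \<noteq> j - n" if "n \<le> j" using that by linarith
      then show ?thesis using True False i(3,4) Suc.prems c dm(1) by auto
    next
      case j: False
      then have "j = n + Q" using Suc.prems by simp
      then show ?thesis using False i(3,4) Suc.prems c dm k by auto
    qed
  qed
qed (use f in auto)

section \<open>Counting zero bricks by nullity and recovering which labels vanish\<close>

text \<open>A homogeneous system with fewer equations than unknowns has a nonzero solution. Padding
  the coefficients with zero rows gives a square matrix whose last row is zero, hence one of
  determinant zero. The solution is extended by zero outside \<open>J\<close>.\<close>

lemma exists_kernel_element:
  fixes c :: "'i \<Rightarrow> 'j \<Rightarrow> 'a :: field"
  assumes "finite I" "finite J" "card I < card J"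
  obtains x where "\<And>j. j \<notin> J \<Longrightarrow> x j = 0" "\<exists>j\<in>J. x j \<noteq> 0" "\<And>i. i \<in> I \<Longrightarrow> (\<Sum>j\<in>J. c i j * x j) = 0"
proof -
  let ?r = "card J"
  obtain g where g: "bij_betw g {0..<?r} J" using ex_bij_betw_nat_finite[OF assms(2)] by blast
  obtain h where h: "bij_betw h {0..<card I} I" using ex_bij_betw_nat_finite[OF assms(1)] by blast
  define A where "A = mat ?r ?r (\<lambda>(i, j). if i < card I then c (h i) (g j) else 0)"
  have A: "A \<in> carrier_mat ?r ?r" by (simp add: A_def)
  have "transpose_mat A *\<^sub>v unit_vec ?r (?r - 1) = 0\<^sub>v ?r"
    using assms(3) by (intro eq_vecI) (auto simp: A_def)
  moreover have "unit_vec ?r (?r - 1) \<noteq> (0\<^sub>v ?r :: 'a vec)" using assms(3) by simp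
  ultimately have "det (transpose_mat A) = 0"
    using A by (subst det_0_iff_vec_prod_zero_field[of _ ?r]) (auto intro!: exI[of _ "unit_vec ?r (?r - 1)"])
  then have "det A = 0" using det_transpose[OF A] by simp
  then obtain w where w: "w \<in> carrier_vec ?r" "w \<noteq> 0\<^sub>v ?r" "A *\<^sub>v w = 0\<^sub>v ?r"
    using det_0_iff_vec_prod_zero_field[OF A] by blast
  define x where "x j = (if j \<in> J then w $ (inv_into {0..<?r} g j) else 0)" for j
  have xg: "x (g a) = w $ a" if "a < ?r" for a
    using that g bij_betw_inv_into_left[OF g, of a] by (auto simp: x_def bij_betw_def)
  show thesis
  proof (rule that[of x])
    show "\<exists>j\<in>J. x j \<noteq> 0"
    proof (rule ccontr)
      assume "\<not> (\<exists>j\<in>J. x j \<noteq> 0)"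
      then have "w $ a = 0" if "a < ?r" for a
        using that xg[OF that] bij_betwE[OF g] by auto
      then have "w = 0\<^sub>v ?r" using w(1) by (intro eq_vecI) auto
      then show False using w(2) by contradiction
    qed
    show "(\<Sum>j\<in>J. c i j * x j) = 0" if i: "i \<in> I" for i
    proof -
      have "i \<in> h ` {0..<card I}" using h i by (simp add: bij_betw_def)
      then obtain b where b: "b < card I" "i = h b" by auto
      have "(\<Sum>j\<in>J. c i j * x j) = (\<Sum>a\<in>{0..<?r}. c i (g a) * x (g a))"
        by (rule sum.reindex_bij_betw[OF g, symmetric])
      also have "\<dots> = (\<Sum>a\<in>{0..<?r}. c i (g a) * w $ a)" by (intro sum.cong) (auto simp: xg)
      also have "\<dots> = (A *\<^sub>v w) $ b" using b assms(3) w(1) by (simp add: A_def scalar_prod_def)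
      also have "\<dots> = 0" using b assms(3) w(3) by simp
      finally show ?thesis .
    qed
  qed (simp add: x_def)
qed

text \<open>\<open>S\<close> embeds the space of vectors supported on \<open>J\<close> into that of
  vectors supported on \<open>I\<close>. If \<open>J\<close> were larger, some nonzero vector
  supported on \<open>J\<close> would be sent to zero.\<close>

lemma card_support_le:
  fixes S :: "'a :: field mat"
  assumes S: "nonsingular b S" and IJ: "I \<subseteq> {..<b}" "J \<subseteq> {..<b}"
    and imp: "\<And>x. x \<in> carrier_vec b \<Longrightarrow> (\<And>j. j < b \<Longrightarrow> j \<notin> J \<Longrightarrow> x $ j = 0) \<Longrightarrow>
      (\<And>i. i < b \<Longrightarrow> i \<notin> I \<Longrightarrow> (S *\<^sub>v x) $ i = 0)"
  shows "card J \<le> card I"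
proof (rule ccontr)
  assume "\<not> card J \<le> card I"
  then have card: "card I < card J" by simp
  have fin: "finite I" "finite J" using IJ finite_subset by blast+
  obtain x where x: "\<And>j. j \<notin> J \<Longrightarrow> x j = 0" "\<exists>j\<in>J. x j \<noteq> 0"
    "\<And>i. i \<in> I \<Longrightarrow> (\<Sum>j\<in>J. S $$ (i, j) * x j) = 0"
    by (rule exists_kernel_element[OF fin card, of "\<lambda>i j. S $$ (i, j)"]) blast
  define y where "y = vec b x"
  obtain S' where S': "S \<in> carrier_mat b b" "S' \<in> carrier_mat b b" "S' * S = 1\<^sub>m b"
    using S by (rule nonsingularE) blast
  have y: "y \<in> carrier_vec b" by (simp add: y_def)
  have "S *\<^sub>v y = 0\<^sub>v b"
  proof (rule eq_vecI)
    fix i assume "i < dim_vec (0\<^sub>v b :: 'a vec)"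
    then have i: "i < b" by simp
    show "(S *\<^sub>v y) $ i = 0\<^sub>v b $ i"
    proof (cases "i \<in> I")
      case True
      have "(S *\<^sub>v y) $ i = (\<Sum>j<b. S $$ (i, j) * x j)"
        using i S' by (simp add: y_def scalar_prod_def atLeast0LessThan)
      also have "\<dots> = (\<Sum>j\<in>J. S $$ (i, j) * x j)"
        using IJ x(1) by (intro sum.mono_neutral_right) auto
      finally show ?thesis using x(3)[OF True] i by simp
    next
      case False
      then show ?thesis using imp[OF y _ i] i x(1) by (simp add: y_def)
    qed
  qed (use S' in simp)
  then have "S' *\<^sub>v (S *\<^sub>v y) = 0\<^sub>v b" using S' by (intro eq_vecI) auto
  moreover have "S' *\<^sub>v (S *\<^sub>v y) = y"
    using assoc_mult_mat_vec[OF S'(2,1) y] S'(3) y by simp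
  ultimately have "y = 0\<^sub>v b" by simp
  then have "x j = 0" if "j < b" for j
    using that index_vec[OF that, of x] unfolding y_def by simp
  then show False using x(2) IJ by auto
qed

lemma add_bricks_mult_vec_index:
  fixes f :: "'b \<Rightarrow> 'a :: field mat"
  assumes f: "f v \<in> carrier_mat m n" and d: "\<And>q. d q v \<in> carrier_mat t 1"
    and "q < Q" "k < t" and x: "x \<in> carrier_vec (n + Q)"
  shows "(add_bricks d f Q v *\<^sub>v x) $ (m + (q * t + k)) = d q v $$ (k, 0) * x $ (n + q)"
proof -
  have lt: "m + (q * t + k) < m + Q * t" using block_index_less[OF assms(3,4)] by simp
  have "(add_bricks d f Q v *\<^sub>v x) $ (m + (q * t + k))
      = (\<Sum>j<n + Q. add_bricks d f Q v $$ (m + (q * t + k), j) * x $ j)"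
    using add_bricks_carrier[of f v m n d t Q] f d x lt by (simp add: scalar_prod_def atLeast0LessThan)
  also have "\<dots> = (\<Sum>j<n + Q. if j = n + q then d q v $$ (k, 0) * x $ (n + q) else 0)"
    using assms(3,4) lt
    by (intro sum.cong refl) (subst add_bricks_index[of f v m n d t], use f d in auto)
  finally show ?thesis using assms(3) by simp
qed

text \<open>If \<open>z\<close> bricks vanish at a parameter, the nullity there lies between
  \<open>z\<close> and \<open>n + z\<close>, since the first summand has only \<open>n\<close>
  columns. Equivalent matrices have the same nullity.\<close>

lemma card_zero_bricks_le:
  fixes f :: "'b \<Rightarrow> 'a :: field mat" and g :: "'c \<Rightarrow> 'a mat"
  assumes f: "f v \<in> carrier_mat m n" and d: "\<And>q. d q v \<in> carrier_mat t 1"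
    and g: "g w \<in> carrier_mat m n" and e: "\<And>q. e q w \<in> carrier_mat t 1" and t: "t > 0"
    and P: "nonsingular (m + Q * t) P" and S: "nonsingular (n + Q) S"
    and eq: "add_bricks e g Q w = P * add_bricks d f Q v * S"
  shows "card {q. q < Q \<and> e q w = 0\<^sub>m t 1} \<le> n + card {q. q < Q \<and> d q v = 0\<^sub>m t 1}"
proof -
  \<comment> \<open>Every vector supported on \<open>?J\<close>, the columns of zero bricks, is
    killed by \<open>?G\<close>. Every vector killed by \<open>?F\<close> is supported on
    \<open>?I\<close>, because a nonzero brick forces its coordinate to be zero; the first
    \<open>n\<close> coordinates are left free.\<close>
  let ?J = "(+) n ` {q. q < Q \<and> e q w = 0\<^sub>m t 1}"
  let ?I = "{..<n} \<union> (+) n ` {q. q < Q \<and> d q v = 0\<^sub>m t 1}"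
  let ?F = "add_bricks d f Q v" and ?G = "add_bricks e g Q w"
  have F: "?F \<in> carrier_mat (m + Q * t) (n + Q)" using f d by (rule add_bricks_carrier)
  have G: "?G \<in> carrier_mat (m + Q * t) (n + Q)" using g e by (rule add_bricks_carrier)
  obtain P' where P': "P \<in> carrier_mat (m + Q * t) (m + Q * t)" "P' \<in> carrier_mat (m + Q * t) (m + Q * t)"
    "P' * P = 1\<^sub>m (m + Q * t)" using P by (rule nonsingularE) blast
  have S': "S \<in> carrier_mat (n + Q) (n + Q)" using S by (simp add: nonsingular_def)
  have "card ?J \<le> card ?I"
  proof (rule card_support_le[OF S])
    fix x :: "'a vec" and i
    assume x: "x \<in> carrier_vec (n + Q)" and x0: "\<And>j. j < n + Q \<Longrightarrow> j \<notin> ?J \<Longrightarrow> x $ j = 0"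
      and i: "i < n + Q" "i \<notin> ?I"
    have Sx: "S *\<^sub>v x \<in> carrier_vec (n + Q)" using S' x by simp
    have "?G *\<^sub>v x = 0\<^sub>v (m + Q * t)"
    proof (rule eq_vecI)
      fix r assume "r < dim_vec (0\<^sub>v (m + Q * t) :: 'a vec)"
      then have r: "r < m + Q * t" by simp
      have "?G $$ (r, j) * x $ j = 0" if j: "j < n + Q" for j
      proof (cases "j \<in> ?J")
        case True
        then have "(r - m) mod t < t" "e (j - n) w = 0\<^sub>m t 1" "\<not> j < n" using t by auto
        then show ?thesis using add_bricks_index[of g w m n e t r Q j] g e t r j by simp
      qed (use x0 j in simp)
      then show "(?G *\<^sub>v x) $ r = 0\<^sub>v (m + Q * t) $ r"
        using G r x by (auto simp: scalar_prod_def intro!: sum.neutral)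
    qed (use G in simp)
    then have "P * ?F *\<^sub>v (S *\<^sub>v x) = 0\<^sub>v (m + Q * t)"
      unfolding eq using assoc_mult_mat_vec[OF mult_carrier_mat[OF P'(1) F] S' x] by simp
    then have "S *\<^sub>v x \<in> mat_kernel (P * ?F)"
      using Sx by (intro mat_kernelI[OF mult_carrier_mat[OF P'(1) F]])
    then have z: "?F *\<^sub>v (S *\<^sub>v x) = 0\<^sub>v (m + Q * t)"
      unfolding mat_kernel_mult_eq[OF F P'(1,2,3)] using mat_kernelD[OF F] by blast
    define q where "q = i - n"
    have q: "i = n + q" "q < Q" using i by (auto simp: q_def)
    then have "d q v \<noteq> 0\<^sub>m t 1" using i by auto
    moreover have "d q v = 0\<^sub>m t 1" if "\<forall>k<t. d q v $$ (k, 0) = 0"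
      using that d[of q] by (intro eq_matI) auto
    ultimately obtain k where k: "k < t" "d q v $$ (k, 0) \<noteq> 0" by blast
    have "d q v $$ (k, 0) * (S *\<^sub>v x) $ (n + q) = 0"
      using add_bricks_mult_vec_index[of f v m n d t q Q k "S *\<^sub>v x"] f d q(2) k(1) Sx z
        block_index_less[OF q(2) k(1)] by simp
    then show "(S *\<^sub>v x) $ i = 0" using k q by simp
  qed auto
  also have "card ?I \<le> card {..<n} + card ((+) n ` {q. q < Q \<and> d q v = 0\<^sub>m t 1})"
    by (rule card_Un_le)
  finally show ?thesis by (simp add: card_image)
qed

text \<open>By uniqueness of binary expansions, the number of positions whose label has a property
  determines the labels with this property, even if it is known only up to an error less than \<open>N\<close>.\<close>

definition binary_labels :: "nat \<Rightarrow> nat \<Rightarrow> nat list" where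
  "binary_labels N s = concat (map (\<lambda>\<alpha>. replicate (N * 2 ^ \<alpha>) \<alpha>) [0..<s])"

lemma set_binary_labels: "set (binary_labels N s) \<subseteq> {..<s}"
  by (auto simp: binary_labels_def)

text \<open>The label \<alpha> is repeated \<open>N * 2 ^ \<alpha>\<close> times, and
  \<open>set_encode\<close> of a finite set is the sum of the corresponding powers of two.\<close>

lemma card_binary_labels:
  "card {q. q < length (binary_labels N s) \<and> Z (binary_labels N s ! q)} = N * set_encode {\<alpha>. \<alpha> < s \<and> Z \<alpha>}"
proof -
  have "length (filter Z (binary_labels N s)) = N * set_encode {\<alpha>. \<alpha> < s \<and> Z \<alpha>}"
  proof (induction s)
    case (Suc s)
    have "{\<alpha>. \<alpha> < Suc s \<and> Z \<alpha>} = (if Z s then insert s {\<alpha>. \<alpha> < s \<and> Z \<alpha>} else {\<alpha>. \<alpha> < s \<and> Z \<alpha>})"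
      by (auto simp: less_Suc_eq)
    then show ?case using Suc by (simp add: binary_labels_def algebra_simps)
  qed (simp add: binary_labels_def)
  then show ?thesis by (simp add: length_filter_conv_card)
qed

text \<open>Both counts are multiples of \<open>Suc n\<close>, so an error of at most
  \<open>n\<close> cannot separate them. Then the encodings are equal, and \<open>set_encode\<close>
  is injective on finite sets.\<close>

lemma binary_labels_determined:
  assumes "card {q. q < length (binary_labels (Suc n) s) \<and> Z (binary_labels (Suc n) s ! q)} \<le>
      n + card {q. q < length (binary_labels (Suc n) s) \<and> Z' (binary_labels (Suc n) s ! q)}"
    and "card {q. q < length (binary_labels (Suc n) s) \<and> Z' (binary_labels (Suc n) s ! q)} \<le>
      n + card {q. q < length (binary_labels (Suc n) s) \<and> Z (binary_labels (Suc n) s ! q)}"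
    and "\<alpha> < s"
  shows "Z \<alpha> \<longleftrightarrow> Z' \<alpha>"
proof -
  have le: "e \<le> e'" if "Suc n * e \<le> n + Suc n * e'" for e e' :: nat
  proof -
    have "Suc n * e < Suc n * Suc e'" using that by (simp only: mult_Suc_right)
    then show ?thesis unfolding mult_less_cancel1 by simp
  qed
  have "set_encode {\<alpha>. \<alpha> < s \<and> Z \<alpha>} = set_encode {\<alpha>. \<alpha> < s \<and> Z' \<alpha>}"
    using le[OF assms(1)[unfolded card_binary_labels]] le[OF assms(2)[unfolded card_binary_labels]]
    by (rule antisym)
  then have "{\<alpha>. \<alpha> < s \<and> Z \<alpha>} = {\<alpha>. \<alpha> < s \<and> Z' \<alpha>}" by (subst (asm) set_encode_eq) auto
  then show ?thesis using assms(3) by blast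
qed

subsection \<open>The encoding array\<close>

text \<open>The array whose pencil is the concatenation plus the bricks with index sets
  \<open>L q\<close>. The corner of size \<open>m\<close> by \<open>n\<close> holds the variables
  for all third indices. In row \<open>k\<close> of brick \<open>q\<close> the constant
  \<open>1\<close> stands at the third indices \<open>l * t + k\<close> with \<open>l\<close> in
  \<open>L q\<close>.\<close>

definition encode_array :: "nat \<Rightarrow> nat \<Rightarrow> nat \<Rightarrow> (nat \<Rightarrow> nat set) \<Rightarrow> varname entry array3" where
  "encode_array m n t L = (\<lambda>a b c.
    if a < m \<and> b < n then Var (c div t, a, b, c mod t)
    else if m \<le> a \<and> n \<le> b \<and> (a - m) div t = b - n \<and> (a - m) mod t = c mod t \<and> c div t \<in> L (b - n)
    then Const1 else Const0)"

lemma pencil_encode_array: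
  fixes A :: "nat \<Rightarrow> 'a :: field array3"
  assumes t: "t > 0"
  shows "pencil (m + Q * t) (n + Q) (p * t) (subst_tuple (encode_array m n t L) A) =
    add_bricks (\<lambda>q. brick p t (L q)) (pencil m n (p * t) (concat_array t A)) Q"
proof
  fix v :: "nat \<Rightarrow> 'a"
  let ?f = "pencil m n (p * t) (concat_array t A)" and ?d = "\<lambda>q. brick p t (L q)"
  let ?G = "subst_tuple (encode_array m n t L) A"
  have N: "add_bricks ?d ?f Q v \<in> carrier_mat (m + Q * t) (n + Q)"
    by (rule add_bricks_carrier) (simp_all del: One_nat_def)
  show "pencil (m + Q * t) (n + Q) (p * t) ?G v = add_bricks ?d ?f Q v"
  proof (rule eq_matI)
    fix i j assume "i < dim_row (add_bricks ?d ?f Q v)" "j < dim_col (add_bricks ?d ?f Q v)"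
    then have lt: "i < m + Q * t" "j < n + Q" using N by auto
    have G: "?G i j c = (if i < m \<and> j < n then concat_array t A i j c
        else if m \<le> i \<and> n \<le> j \<and> (i - m) div t = j - n \<and> c mod t = (i - m) mod t \<and> c div t \<in> L (j - n)
        then 1 else 0)" for c
      by (auto simp: subst_tuple_def encode_array_def concat_array_def)
    have "pencil (m + Q * t) (n + Q) (p * t) ?G v $$ (i, j) = (\<Sum>c<p * t. v c * ?G i j c)"
      using lt by (simp add: pencil_def)
    also have "\<dots> = (if i < m \<and> j < n then ?f v $$ (i, j)
     else if m \<le> i \<and> n \<le> j \<and> (i - m) div t = j - n then ?d (j - n) v $$ ((i - m) mod t, 0) else 0)"
    proof -
      consider "i < m \<and> j < n" | "\<not> (i < m \<and> j < n)" "m \<le> i \<and> n \<le> j \<and> (i - m) div t = j - n"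
        | "\<not> (i < m \<and> j < n)" "\<not> (m \<le> i \<and> n \<le> j \<and> (i - m) div t = j - n)" by blast
      then show ?thesis
      proof cases
        case 1
        then show ?thesis by (simp add: G pencil_def)
      next
        case 2
        have "(\<Sum>c<p * t. v c * ?G i j c)
          = (\<Sum>c<p * t. if c mod t = (i - m) mod t \<and> c div t \<in> L (j - n) then v c else 0)"
          using 2 by (intro sum.cong) (auto simp: G)
        then show ?thesis using 2 t by (simp add: brick_def)
      next
        case 3
        have "?G i j c = 0" for c unfolding G using 3 by auto
        then show ?thesis using 3 by auto
      qed
    qed
    also have "\<dots> = add_bricks ?d ?f Q v $$ (i, j)"
      by (rule add_bricks_index[symmetric]) (use t lt in \<open>simp_all del: One_nat_def\<close>)
    finally show "pencil (m + Q * t) (n + Q) (p * t) ?G v $$ (i, j) = add_bricks ?d ?f Q v $$ (i, j)" .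
  qed (use N in \<open>auto simp: pencil_def\<close>)
qed

text \<open>The array \<open>l\<close> of the tuple sits in the corner of size \<open>m\<close> by
  \<open>n\<close> over the interval of third indices of block \<open>l\<close>. These intervals
  cover all third indices, so any entry outside the subarrays lies outside the corner and is
  constant.\<close>

lemma contains_generic_tuple_encode_array:
  assumes "m > 0" "n > 0" "t > 0"
  shows "contains_generic_tuple p m n t (m + Q * t) (n + Q) (p * t) (encode_array m n t L)"
proof -
  let ?J = "\<lambda>l. {l * t..<l * t + t}"
  have sub: "subarray_at m n t (generic_tuple l) (m + Q * t) (n + Q) (p * t) (encode_array m n t L)
      {0..<m} {0..<n} (?J l)" if "l < p" for l
  proof -
    have "?J l \<subseteq> {..<p * t}"
    proof
      fix c assume "c \<in> ?J l"
      then have "c = l * t + (c - l * t)" "c - l * t < t" by auto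
      then show "c \<in> {..<p * t}" using block_index_less[OF that, of "c - l * t" t] by simp
    qed
    moreover have "encode_array m n t L i j (l * t + k) = Var (l, i, j, k)"
      if "i < m" "j < n" "k < t" for i j k
      using that by (simp add: encode_array_def)
    moreover have "{0..<m} \<subseteq> {..<m + Q * t}" "{0..<n} \<subseteq> {..<n + Q}" by auto
    ultimately show ?thesis using assms
      unfolding subarray_at_def generic_tuple_def by simp
  qed
  have "encode_array m n t L a b c \<in> {Const0, Const1}"
    if "c < p * t" "\<not> (\<exists>l<p. a \<in> {0..<m} \<and> b \<in> {0..<n} \<and> c \<in> ?J l)" for a b c
  proof -
    have "c div t * t \<le> c" "c < c div t * t + t"
      using div_mult_mod_eq[of c t] mod_less_divisor[OF assms(3), of c] by linarith+
    then have "c div t < p" "c \<in> ?J (c div t)"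
      using that(1) by (auto simp: less_mult_imp_div_less)
    then have "\<not> (a < m \<and> b < n)" using that(2) by auto
    then show ?thesis by (auto simp: encode_array_def)
  qed
  with sub have "(\<forall>l<p. subarray_at m n t (generic_tuple l) (m + Q * t) (n + Q) (p * t)
        (encode_array m n t L) {0..<m} {0..<n} (?J l)) \<and>
      (\<forall>a<m + Q * t. \<forall>b<n + Q. \<forall>c<p * t.
        \<not> (\<exists>l<p. a \<in> {0..<m} \<and> b \<in> {0..<n} \<and> c \<in> ?J l) \<longrightarrow>
        encode_array m n t L a b c \<in> {Const0, Const1})"
    by (intro conjI allI impI)
  then show ?thesis unfolding contains_generic_tuple_def
    by (rule exI[where x = "\<lambda>_. {0..<m}", OF exI[where x = "\<lambda>_. {0..<n}", OF exI[where x = ?J]]])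
qed

section \<open>The two directions of the reduction\<close>

lemma add_bricks_comp:
  "add_bricks d f Q (h v) = add_bricks (\<lambda>q v. d q (h v)) (\<lambda>v. f (h v)) Q v"
  by (induction Q) simp_all

text \<open>The action of \<open>diag_copies p t U\<close> multiplies each brick on the left by
  \<open>U\<close>. The inverse of \<open>U\<close> on the rows of each brick restores it, while the
  first summand keeps its changed parameter.\<close>

lemma pencil_equiv_untwist:
  fixes f :: "(nat \<Rightarrow> 'a :: field) \<Rightarrow> 'a mat"
  assumes U: "nonsingular t U" and f: "\<And>v. f v \<in> carrier_mat m n"
  shows "pencil_equiv (m + Q * t) (n + Q)
    (\<lambda>v. add_bricks (\<lambda>q. brick p t (L q)) f Q (act (p * t) (diag_copies p t U) v))
    (add_bricks (\<lambda>q. brick p t (L q)) (\<lambda>v. f (act (p * t) (diag_copies p t U) v)) Q)"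
proof -
  let ?h = "act (p * t) (diag_copies p t U)"
  obtain U' where U': "U \<in> carrier_mat t t" "U' \<in> carrier_mat t t" "nonsingular t U'" "U' * U = 1\<^sub>m t"
    using U by (rule nonsingularE) blast
  have brick: "pencil_equiv t 1 (\<lambda>v. brick p t (L q) (?h v)) (brick p t (L q))" for q
  proof -
    have "brick p t (L q) v = U' * brick p t (L q) (?h v) * 1\<^sub>m 1" for v
    proof -
      have "U' * brick p t (L q) (?h v) = (U' * U) * brick p t (L q) v"
        unfolding brick_act_diag_copies[OF U'(1)]
        by (rule assoc_mult_mat[OF U'(2,1) brick_carrier, symmetric])
      then show ?thesis unfolding U'(4)
        using left_mult_one_mat[OF brick_carrier[of p t "L q" v]]
          right_mult_one_mat[OF brick_carrier[of p t "L q" v]] by simp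
    qed
    then show ?thesis using U'(3) nonsingular_one unfolding pencil_equiv_def by blast
  qed
  have "(\<lambda>v. add_bricks (\<lambda>q. brick p t (L q)) f Q (?h v))
      = add_bricks (\<lambda>q v. brick p t (L q) (?h v)) (\<lambda>v. f (?h v)) Q"
    by (rule ext) (rule add_bricks_comp)
  moreover have "pencil_equiv m n (\<lambda>v. f (?h v)) (\<lambda>v. f (?h v))"
    by (rule pencil_equiv_refl) (rule f)
  ultimately show ?thesis
    by (simp only:) (rule pencil_equiv_add_bricks[OF _ _ _ brick]; simp add: f del: One_nat_def)
qed

theorem corollary3p2:
  fixes p m n t :: nat
  assumes "p > 0" and "m > 0" and "n > 0" and "t > 0"
  shows "\<exists>d1 d2 d3 :: nat. \<exists>F :: varname entry array3.
           d1 > 0 \<and> d2 > 0 \<and> d3 > 0 \<and>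
           contains_generic_tuple p m n t d1 d2 d3 F \<and>
           (\<forall>A B :: nat \<Rightarrow> 'a :: field array3.
              simultaneously_equivalent3 p m n t A B \<longleftrightarrow>
              equivalent3 d1 d2 d3 (subst_tuple F A) (subst_tuple F B))"
proof -
  \<comment> \<open>The multiplicities contain the factor \<open>Suc n\<close>, which exceeds the
    uncertainty \<open>n\<close> in \<open>card_zero_bricks_le\<close>. There are
    \<open>p * p\<close> labels, one for each ordered pair of block numbers.\<close>
  define \<rho> where "\<rho> = binary_labels (Suc n) (p * p)"
  define Q where "Q = length \<rho>"
  \<comment> \<open>The label \<open>l * p + l'\<close> stands for the set \<open>{l, l'}\<close>;
    equal members give the one-element sets.\<close>
  define lab :: "nat \<Rightarrow> nat set" where "lab \<alpha> = {\<alpha> div p, \<alpha> mod p}" for \<alpha>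
  define L where "L q = lab (\<rho> ! q)" for q
  define F where "F = encode_array m n t L"
  let ?brick = "\<lambda>q. brick p t (L q) :: (nat \<Rightarrow> 'a) \<Rightarrow> 'a mat"
  let ?a = "m + Q * t" and ?b = "n + Q"
  \<comment> \<open>Each brick thus involves at least one actual block of \<open>v\<close>, which
    makes its endomorphisms scalar.\<close>
  have L: "\<rho> ! q div p < p" if "q < Q" for q
  proof -
    have "\<rho> ! q < p * p"
      using nth_mem[of q \<rho>] that set_binary_labels[of "Suc n" "p * p"] unfolding \<rho>_def Q_def by blast
    then show ?thesis by (rule less_mult_imp_div_less)
  qed
  have "simultaneously_equivalent3 p m n t A B \<longleftrightarrow>
      equivalent3 ?a ?b (p * t) (subst_tuple F A) (subst_tuple F B)" for A B :: "nat \<Rightarrow> 'a array3"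
  proof -
    define f where "f = pencil m n (p * t) (concat_array t A)"
    define g where "g = pencil m n (p * t) (concat_array t B)"
    have f: "f v \<in> carrier_mat m n" and g: "g v \<in> carrier_mat m n" for v
      by (simp_all add: f_def g_def)
    let ?N = "add_bricks ?brick"
    have N: "?N f' Q v \<in> carrier_mat ?a ?b" if "\<And>v. f' v \<in> carrier_mat m n" for f' v
      by (rule add_bricks_carrier) (simp_all add: that del: One_nat_def)
    have eqv: "equivalent3 ?a ?b (p * t) (subst_tuple F A) (subst_tuple F B) \<longleftrightarrow>
      (\<exists>U. nonsingular (p * t) U \<and> pencil_equiv ?a ?b (\<lambda>v. ?N f Q (act (p * t) U v)) (?N g Q))"
      unfolding equivalent3_iff_pencil_equiv F_def pencil_encode_array[OF \<open>t > 0\<close>] f_def g_def ..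
    have sim: "simultaneously_equivalent3 p m n t A B \<longleftrightarrow>
      (\<exists>U. nonsingular t U \<and> pencil_equiv m n (\<lambda>v. f (act (p * t) (diag_copies p t U) v)) g)"
      unfolding simultaneously_equivalent3_iff_pencil_equiv[OF \<open>t > 0\<close>] f_def g_def ..
    show ?thesis
    proof
      assume "simultaneously_equivalent3 p m n t A B"
      then obtain U where U: "nonsingular t U"
        and fg: "pencil_equiv m n (\<lambda>v. f (act (p * t) (diag_copies p t U) v)) g"
        unfolding sim by blast
      let ?f = "\<lambda>v. f (act (p * t) (diag_copies p t U) v)"
      \<comment> \<open>The bricks are the same on both sides, so the equivalence of
        \<open>?f\<close> and \<open>g\<close> extends by the identity on them; the action of
        \<open>U\<close> on the bricks is then absorbed by
        \<open>pencil_equiv_untwist\<close>.\<close>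
      have "pencil_equiv ?a ?b (?N ?f Q) (?N g Q)"
        by (rule pencil_equiv_add_bricks[OF _ _ fg])
          (simp_all add: f pencil_equiv_refl del: One_nat_def)
      with pencil_equiv_untwist[OF U f]
      have "pencil_equiv ?a ?b (\<lambda>v. ?N f Q (act (p * t) (diag_copies p t U) v)) (?N g Q)"
        by (rule pencil_equiv_trans[OF N[OF f]])
      then show "equivalent3 ?a ?b (p * t) (subst_tuple F A) (subst_tuple F B)"
        unfolding eqv using nonsingular_diag_copies[OF \<open>t > 0\<close> U] by blast
    next
      assume "equivalent3 ?a ?b (p * t) (subst_tuple F A) (subst_tuple F B)"
      then obtain W where W: "nonsingular (p * t) W"
        and equiv: "pencil_equiv ?a ?b (\<lambda>v. ?N f Q (act (p * t) W v)) (?N g Q)"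
        unfolding eqv by blast
      have equiv': "pencil_equiv ?a ?b (?N g Q) (\<lambda>v. ?N f Q (act (p * t) W v))"
        by (rule pencil_equiv_sym[OF N[OF f] equiv])
      \<comment> \<open>The equivalence and its inverse bound the numbers of zero bricks at
        \<open>v\<close> and at its image by each other up to \<open>n\<close>, so the same labels
        vanish at both parameters.\<close>
      have pattern: "brick p t (lab \<alpha>) v = 0\<^sub>m t 1 \<longleftrightarrow> brick p t (lab \<alpha>) (act (p * t) W v) = 0\<^sub>m t 1"
        if "\<alpha> < p * p" for \<alpha> v
      proof (rule binary_labels_determined[OF _ _ that, of n])
        obtain P S where PS: "nonsingular ?a P" "nonsingular ?b S" "?N g Q v = P * ?N f Q (act (p * t) W v) * S"
          using equiv unfolding pencil_equiv_def by blast
        show "card {q. q < length (binary_labels (Suc n) (p * p)) \<and>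
            brick p t (lab (binary_labels (Suc n) (p * p) ! q)) v = 0\<^sub>m t 1}
          \<le> n + card {q. q < length (binary_labels (Suc n) (p * p)) \<and>
            brick p t (lab (binary_labels (Suc n) (p * p) ! q)) (act (p * t) W v) = 0\<^sub>m t 1}"
          using card_zero_bricks_le[OF f brick_carrier g brick_carrier \<open>t > 0\<close> PS]
          unfolding \<rho>_def[symmetric] Q_def[symmetric] L_def .
        obtain P S where PS: "nonsingular ?a P" "nonsingular ?b S" "?N f Q (act (p * t) W v) = P * ?N g Q v * S"
          using equiv' unfolding pencil_equiv_def by blast
        show "card {q. q < length (binary_labels (Suc n) (p * p)) \<and>
            brick p t (lab (binary_labels (Suc n) (p * p) ! q)) (act (p * t) W v) = 0\<^sub>m t 1}
          \<le> n + card {q. q < length (binary_labels (Suc n) (p * p)) \<and>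
            brick p t (lab (binary_labels (Suc n) (p * p) ! q)) v = 0\<^sub>m t 1}"
          using card_zero_bricks_le[OF g brick_carrier f brick_carrier \<open>t > 0\<close> PS]
          unfolding \<rho>_def[symmetric] Q_def[symmetric] L_def .
      qed
      have "W \<in> carrier_mat (p * t) (p * t)" using W by (simp add: nonsingular_def)
      moreover have "brick p t {l, l'} (act (p * t) W v) = 0\<^sub>m t 1"
        if "l < p" "l' < p" "brick p t {l, l'} v = 0\<^sub>m t 1" for l l' v
      proof -
        have "lab (l * p + l') = {l, l'}" using that by (simp add: lab_def)
        then show ?thesis using pattern[of "l * p + l'" v] block_index_less[of l p l' p] that by simp
      qed
      \<comment> \<open>Here the arbitrary third matrix \<open>W\<close> acquires the shape required
        by simultaneous equivalence.\<close>
      ultimately obtain U where U: "U \<in> carrier_mat t t" "W = diag_copies p t U"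
        using diag_copies_of_bricks_preserved[OF \<open>p > 0\<close>, of W t] by blast
      have ns: "nonsingular t U"
        using nonsingular_of_diag_copies[OF \<open>p > 0\<close> \<open>t > 0\<close> U(1)] W U(2) by simp
      let ?f = "\<lambda>v. f (act (p * t) W v)"
      \<comment> \<open>Undoing the action of \<open>W\<close> on the bricks leaves identical bricks
        beside \<open>?f\<close> and \<open>g\<close>, as cancellation requires.\<close>
      have "pencil_equiv ?a ?b (?N ?f Q) (\<lambda>v. ?N f Q (act (p * t) W v))"
        unfolding U(2) by (rule pencil_equiv_sym[OF N[OF f] pencil_equiv_untwist[OF ns f]])
      then have "pencil_equiv ?a ?b (?N ?f Q) (?N g Q)"
        using equiv by (rule pencil_equiv_trans[OF N[OF f]])
      then have "pencil_equiv m n ?f g"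
      proof (rule pencil_equiv_cancel_bricks[OF f g brick_carrier, rotated])
        fix q X Y
        assume q: "q < Q" and "X \<in> carrier_mat t t" "Y \<in> carrier_mat 1 1"
          "\<And>v. X * ?brick q v = ?brick q v * Y"
        moreover have "\<rho> ! q div p \<in> L q" by (simp add: L_def lab_def)
        ultimately show "\<exists>c. X = c \<cdot>\<^sub>m 1\<^sub>m t \<and> Y = c \<cdot>\<^sub>m 1\<^sub>m 1"
          by (intro brick_endomorphism_scalar[OF L[OF q]])
      qed
      then show "simultaneously_equivalent3 p m n t A B" unfolding sim using ns U(2) by blast
    qed
  qed
  moreover have "contains_generic_tuple p m n t ?a ?b (p * t) F"
    unfolding F_def by (rule contains_generic_tuple_encode_array) (use assms in simp_all)
  moreover have "?a > 0" "?b > 0" "p * t > 0" using assms by simp_all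
  ultimately show ?thesis by blast
qed

end
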